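(* Given a planning problem $\mathcal{P}=\langle \mathcal{E}, s_0, \mathcal{G}\rangle$, an integer $N$, and $LGT^{\star}\in(0,1)$, the search algorithm Pandor (the specific procedure Pandor-synth given in pseudocode in the context) is sound and complete: (Soundness) every finite state controller $C$ returned by Pandor-synth is $N$-bounded and satisfies $\mathbf{LGT}\ge LGT^{\star}$ for $\mathcal{P}$; and (Completeness) if there exists an $N$-bounded finite state controller that satisfies $\mathbf{LGT}\ge LGT^{\star}$ for $\mathcal{P}$, then one such finite state controller will be found by Pandor-synth.
   Context: DEFINITIONS. An environment is a tuple $\mathcal{E}=\langle \mathcal{S},\mathcal{A},\mathcal{O},\Delta,\Omega\rangle$, where $\mathcal{S},\mathcal{A},\mathcal{O}$ are finite sets (states, actions, observations), $\Delta:\mathcal{S}\times\mathcal{A}\to\Pi(\mathcal{S})$ is a stochastic state transition function ($\Pi(\mathcal{S})$ is the set of probability distributions on $\mathcal{S}$; $\Delta(s'\mid s,a)$ is the probability of $s'$ under $\Delta(s,a)$), and $\Omega:\mathcal{S}\to\mathcal{O}$ is an observation function. A planning problem is a triple $\mathcal{P}=\langle\mathcal{E},s_0,\mathcal{G}\rangle$ with $\mathcal{E}$ an environment with state space $\mathcal{S}$, $s_0\in\mathcal{S}$ the initial state and $\mathcal{G}\subset\mathcal{S}$ the set of goal states. A finite state controller (FSC) is a tuple $C=\langle Q,q_0,\mathcal{O},\mathcal{A},\gamma,\delta\rangle$, where $Q$ is a finite set of controller states with initial state $q_0$, $\gamma:Q\times\mathcal{O}\to\mathcal{A}\cup\{\texttt{stop}\}$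 is a partial function (labeling function; $\texttt{stop}$ is a special action that ends execution), and $\delta:Q\times\mathcal{O}\to Q$ is a partial function (transition function). $C$ is $N$-bounded if it has at most $N$ controller states. A history of the system $\langle\mathcal{E},C\rangle$ for $\mathcal{P}$ is a finite sequence $h=\langle\langle q^{(t)},s^{(t)}\rangle\rangle_{t=0}^{T}$ in $Q\times\mathcal{S}$ starting at $\langle q_0,s_0\rangle$ such that, for each $0\le t<T$, with $a^{(t)}:=\gamma(q^{(t)},\Omega(s^{(t)}))$, one has $q^{(t+1)}=\delta(q^{(t)},\Omega(s^{(t)}))$ and $\Delta(s^{(t+1)}\mid s^{(t)},a^{(t)})>0$. Its likelihood is $\ell(h)=\prod_{t=0}^{T-1}\Delta(s^{(t+1)}\mid s^{(t)},a^{(t)})$ (empty product $=1$). It is terminating if $a^{(T)}=\texttt{stop}$, and a goal history if moreover $s^{(T)}\in\mathcal{G}$. The total likelihood of goal termination of $\langle\mathcal{E},C\rangle$ on $\mathcal{P}$ is $\mathbf{LGT}:=\sum_{h\text{ a goal history}}\ell(h)$. CONVENTIONS FOR THE PSEUDOCODE. Controller states are $0,\dots,N-1$, with initial state $0$. A (partial) controller $C$ is treated as a set of transitions $q\xrightarrow{o/a}q'$, meaning $\gamma(q,o)=a$ and $\delta(q,o)=q'$; $C_\varepsilon$ is the empty controller. The current history is a sequence $h=h^{(0:n)}$ with $h^{(t)}=\langle q^{(t)},s^{(t)},p^{(t)}\rangle$, where $p^{(t)}$ is the probability of the transition into $s^{(t)}$; $\langle\rangle$ is the empty sequence and $\cdot$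 appends. $s_{\rm win}$ and $s_{\rm fail}$ are special symbols for having stopped in a goal, respectively non-goal, state. $\boldsymbol\alpha$ is a global variable consisting of vectors $\alpha_{\rm goal}^{(k)},\alpha_{\rm fail}^{(k)},\alpha_{\rm noter}^{(k)}$ and a matrix $\alpha_{\rm loop}^{(k,m)}$. "non-det. branch" enumerates the listed choices; "fail this non-deterministic branch" reverts the program state to the last non-deterministic choice point, where another choice is tried. When the lower bound $\lambda_{\rm goal}$ reaches $LGT^\star$, the current controller is good enough and the algorithm returns with success. PANDOR (input $\mathcal{P}$, $N$, $LGT^\star$). Pandor-synth($\mathcal{P},N$): $\boldsymbol\alpha\gets\langle\rangle$ (global); return AND-step($C_\varepsilon,0,\{\langle s_0,1.0\rangle\},\langle\rangle$). AND-step($C,q,SP',h^{(0:n)}$): $\alpha_x^{(n+1)}\gets0$ for $x\in\{\rm goal,fail,noter\}$; $\alpha_{\rm loop}^{(n+1,:)}\gets0$; $\alpha_{\rm loop}^{(:,n+1)}\gets0$. For all $\langle s',p'\rangle\in SP'$: - $C\gets$ OR-step($C,q,s',p',h$); - $\boldsymbol\lambda=\langle\lambda_{\rm goal},\lambda_{\rm fail},\lambda_{\rm noter}\rangle\gets$ CalcLambda($h,\boldsymbol\alpha$); - if $\lambda_{\rm goal}\ge LGT^\star$: return $C$; else if $1-\lambda_{\rm fail}-\lambda_{\rm noter}<LGT^\star$: fail this non-deterministic branch. After the loop: $\boldsymbol\alpha\gets$ CumulateAlpha($h,\boldsymbol\alpha$); return $C$. OR-step($C,q,s,p,h^{(0:n)}$):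 - If $s=s_{\rm win}$: $\alpha_{\rm goal}^{(n+1)}\gets\alpha_{\rm goal}^{(n+1)}+p$; return $C$. - Else if $s=s_{\rm fail}$: $\alpha_{\rm fail}^{(n+1)}\gets\alpha_{\rm fail}^{(n+1)}+p$; return $C$. - Else if $q^{(k)}=q$ and $s^{(k)}=s$ for some $k$: if $p=1$ and $p^{(i)}=1$ for all $k+1\le i\le n$, then $\alpha_{\rm noter}^{(n+1)}\gets1$ and return $C$; otherwise $\alpha_{\rm loop}^{(k,n)}\gets\alpha_{\rm loop}^{(k,n)}+p$ and return $C$. - Else if $q\xrightarrow{\Omega(s)/a}q'\in C$ for some $a,q'$: $SP'\gets$ NextStates($s,a$); return AND-step($C,q',SP',h\cdot\langle q,s,p\rangle$). - Else: non-det. branch over $a\in\mathcal{A}\cup\{\texttt{stop}\}$ and $q'\in\{0,\dots,N-1\}$: $C'\gets C\cup\{q\xrightarrow{\Omega(s)/a}q'\}$; $SP'\gets$ NextStates($s,a$); return AND-step($C',q',SP',h\cdot\langle q,s,p\rangle$). CumulateAlpha($h^{(0:n)},\boldsymbol\alpha$): For all $x\in\{\rm goal,fail,noter\}$: $\alpha_x^{(n)}\gets\alpha_x^{(n)}+p^{(n)}\alpha_x^{(n+1)}/(1-\alpha_{\rm loop}^{(n,n)})$. For $k=0,\dots,n-1$: $\alpha_{\rm loop}^{(k,n-1)}\gets\alpha_{\rm loop}^{(k,n-1)}+p^{(n)}\alpha_{\rm loop}^{(k,n)}/(1-\alpha_{\rm loop}^{(n,n)})$; $\alpha_{\rm loop}^{(k,n)}\gets0$.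 $\alpha_{\rm loop}^{(n,n)}\gets0$; return $\boldsymbol\alpha$. NextStates($s,a$): if $a=\texttt{stop}$ and $s\in\mathcal{G}$ return $\{\langle s_{\rm win},1.0\rangle\}$; if $a=\texttt{stop}$ and $s\notin\mathcal{G}$ return $\{\langle s_{\rm fail},1.0\rangle\}$; else return $\{\langle s',p'\rangle\mid\Delta(s'\mid s,a)=p'>0\}$. CalcLambda($h^{(0:n)},\boldsymbol\alpha$): $\lambda_x\gets\alpha_x^{(n+1)}$ for $x\in\{\rm goal,fail,noter\}$; $\lambda_{\rm loop}^{(0:n)}\gets[0,\dots,0]$. For $k=n,\dots,0$ (descending): - $\lambda_{\rm loop}^{(k)}\gets0$; - for $m=n,\dots,k+1$ (descending): $\lambda_{\rm loop}^{(k)}\gets\lambda_{\rm loop}^{(k)}+\alpha_{\rm loop}^{(k,m)}/(1-\lambda_{\rm loop}^{(m)})$, then $\lambda_{\rm loop}^{(k)}\gets p^{(m)}\cdot\lambda_{\rm loop}^{(k)}$; - $\lambda_{\rm loop}^{(k)}\gets\lambda_{\rm loop}^{(k)}+\alpha_{\rm loop}^{(k,k)}$; - if $\lambda_{\rm loop}^{(k)}+\lambda_{\rm noter}\approx1$: $\lambda_{\rm loop}^{(k)}\gets0$; $\alpha_{\rm loop}^{(k:,k:)}\gets0$ (all entries with both indices $\ge k$); $\alpha_{\rm noter}^{(k)}\gets\alpha_{\rm noter}^{(k)}+p^{(k)}$; and $\lambda_x\gets\alpha_x^{(k)}$ for all $x\in\{\rm goal,fail,noter\}$; - else: $\lambda_x\gets\alpha_x^{(k)}+p^{(k)}\lambda_x/(1-\lambda_{\rm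 loop}^{(k)})$ for all $x\in\{\rm goal,fail,noter\}$. Return $\langle\lambda_{\rm goal},\lambda_{\rm fail},\lambda_{\rm noter}\rangle$.
   Formalization: In CalcLambda, when λ_loop^(k)+λ_noter ≈ 1 (read as exact equality), the formal Pandor also sets α_noter^(i) to 0 for all i>k; without this added assignment CumulateAlpha counts non-terminating mass twice and completeness fails. *)

theory Defs
  imports "HOL-Probability.Probability"
begin

section \<open>Planning problems\<close>

record ('s, 'a, 'o) environment =
  states :: "'s set"
  actions :: "'a set"
  observations :: "'o set"
  delta :: "'s \<Rightarrow> 'a \<Rightarrow> 's pmf"
  obs :: "'s \<Rightarrow> 'o"

definition environment :: "('s, 'a, 'o) environment \<Rightarrow> bool" where
  "environment E \<longleftrightarrow>
     finite (states E) \<and> finite (actions E) \<and> finite (observations E) \<and>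
     (\<forall>s\<in>states E. \<forall>a\<in>actions E. set_pmf (delta E s a) \<subseteq> states E) \<and>
     (\<forall>s\<in>states E. obs E s \<in> observations E)"

record ('s, 'a, 'o) problem =
  env :: "('s, 'a, 'o) environment"
  init :: 's
  goals :: "'s set"

definition planning_problem :: "('s, 'a, 'o) problem \<Rightarrow> bool" where
  "planning_problem P \<longleftrightarrow>
     environment (env P) \<and> init P \<in> states (env P) \<and> goals P \<subseteq> states (env P)"


section \<open>Finite state controllers and their likelihood of goal termination\<close>

datatype 'a command = Act 'a | Stop

definition commands :: "('s, 'a, 'o) environment \<Rightarrow> 'a command set" where
  "commands E = insert Stop (Act ` actions E)"

record ('q, 'o, 'a) fsc =
  cstates :: "'q set"
  start :: 'q
  label :: "'q \<times> 'o \<rightharpoonup> 'a command"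
  succ :: "'q \<times> 'o \<rightharpoonup> 'q"

definition is_fsc :: "('s, 'a, 'o) environment \<Rightarrow> ('q, 'o, 'a) fsc \<Rightarrow> bool" where
  "is_fsc E C \<longleftrightarrow>
     finite (cstates C) \<and> start C \<in> cstates C \<and>
     dom (label C) \<subseteq> cstates C \<times> observations E \<and> ran (label C) \<subseteq> commands E \<and>
     dom (succ C) \<subseteq> cstates C \<times> observations E \<and> ran (succ C) \<subseteq> cstates C"

definition bounded_by :: "nat \<Rightarrow> ('q, 'o, 'a) fsc \<Rightarrow> bool" where
  "bounded_by N C \<longleftrightarrow> card (cstates C) \<le> N"

definition command_at ::
  "('s, 'a, 'o) problem \<Rightarrow> ('q, 'o, 'a) fsc \<Rightarrow> 'q \<times> 's \<Rightarrow> 'a command option" where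
  "command_at P C = (\<lambda>(q, s). label C (q, obs (env P) s))"

definition succ_at ::
  "('s, 'a, 'o) problem \<Rightarrow> ('q, 'o, 'a) fsc \<Rightarrow> 'q \<times> 's \<Rightarrow> 'q option" where
  "succ_at P C = (\<lambda>(q, s). succ C (q, obs (env P) s))"

text \<open>A history with last index \<open>T\<close> is a list of length \<open>T + 1\<close>.\<close>

definition histories ::
  "('s, 'a, 'o) problem \<Rightarrow> ('q, 'o, 'a) fsc \<Rightarrow> ('q \<times> 's) list set" where
  "histories P C =
     {h. h \<noteq> [] \<and> hd h = (start C, init P) \<and> set h \<subseteq> cstates C \<times> states (env P) \<and>
         (\<forall>t. Suc t < length h \<longrightarrow>
            succ_at P C (h ! t) = Some (fst (h ! Suc t)) \<and>
            (\<exists>a. command_at P C (h ! t) = Some (Act a) \<and>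
                 pmf (delta (env P) (snd (h ! t)) a) (snd (h ! Suc t)) > 0))}"

definition likelihood ::
  "('s, 'a, 'o) problem \<Rightarrow> ('q, 'o, 'a) fsc \<Rightarrow> ('q \<times> 's) list \<Rightarrow> real" where
  "likelihood P C h =
     (\<Prod>t<length h - 1.
        case command_at P C (h ! t) of
          Some (Act a) \<Rightarrow> pmf (delta (env P) (snd (h ! t)) a) (snd (h ! Suc t))
        | _ \<Rightarrow> 0)"

definition goal_histories ::
  "('s, 'a, 'o) problem \<Rightarrow> ('q, 'o, 'a) fsc \<Rightarrow> ('q \<times> 's) list set" where
  "goal_histories P C =
     {h \<in> histories P C. command_at P C (last h) = Some Stop \<and> snd (last h) \<in> goals P}"

definition LGT :: "('s, 'a, 'o) problem \<Rightarrow> ('q, 'o, 'a) fsc \<Rightarrow> real" where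
  "LGT P C = (\<Sum>\<^sub>\<infinity>h\<in>goal_histories P C. likelihood P C h)"


section \<open>The bookkeeping of Pandor\<close>

text \<open>A partial controller as a set of transitions: \<open>C (q, o) = Some (a, q')\<close> stands for the
  transition from \<open>q\<close> to \<open>q'\<close> that is labelled \<open>o/a\<close>.\<close>

type_synonym ('o, 'a) ctrl = "nat \<times> 'o \<rightharpoonup> 'a command \<times> nat"

definition fsc_of :: "nat \<Rightarrow> ('o, 'a) ctrl \<Rightarrow> (nat, 'o, 'a) fsc" where
  "fsc_of N C =
     \<lparr>cstates = {..<N}, start = 0,
      label = (\<lambda>qo. map_option fst (C qo)), succ = (\<lambda>qo. map_option snd (C qo))\<rparr>"

datatype 's node = State 's | Win | Fail

text \<open>The history \<open>h\<^sup>(\<^sup>0\<^sup>:\<^sup>n\<^sup>)\<close> is a list of length \<open>n + 1\<close>, with \<open>n = -1\<close> for the empty history.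
  So the index \<open>n + 1\<close> is \<open>length h\<close>.\<close>

type_synonym 's hist = "(nat \<times> 's \<times> real) list"

definition prob_at :: "'s hist \<Rightarrow> nat \<Rightarrow> real" where
  "prob_at h k = snd (snd (h ! k))"

datatype kind = Goal | Failed | Noter

record alpha =
  avec :: "kind \<Rightarrow> nat \<Rightarrow> real"
  aloop :: "nat \<Rightarrow> nat \<Rightarrow> real"

definition alpha_empty :: alpha where
  "alpha_empty = \<lparr>avec = (\<lambda>x k. 0), aloop = (\<lambda>k m. 0)\<rparr>"

definition set_avec :: "kind \<Rightarrow> nat \<Rightarrow> real \<Rightarrow> alpha \<Rightarrow> alpha" where
  "set_avec x i v \<alpha> = \<alpha>\<lparr>avec := (avec \<alpha>)(x := (avec \<alpha> x)(i := v))\<rparr>"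

definition set_aloop :: "nat \<Rightarrow> nat \<Rightarrow> real \<Rightarrow> alpha \<Rightarrow> alpha" where
  "set_aloop k m v \<alpha> = \<alpha>\<lparr>aloop := (aloop \<alpha>)(k := (aloop \<alpha> k)(m := v))\<rparr>"

definition reset_alpha :: "nat \<Rightarrow> alpha \<Rightarrow> alpha" where
  "reset_alpha j \<alpha> =
     \<lparr>avec = (\<lambda>x i. if i = j then 0 else avec \<alpha> x i),
      aloop = (\<lambda>k m. if k = j \<or> m = j then 0 else aloop \<alpha> k m)\<rparr>"

text \<open>At the top level the history is empty and there is no index \<open>n\<close> to accumulate into.\<close>

definition cumulate_alpha :: "'s hist \<Rightarrow> alpha \<Rightarrow> alpha" where
  "cumulate_alpha h \<alpha> =
     (if h = [] then \<alpha>
      else let n = length h - 1; p = prob_at h n; d = 1 - aloop \<alpha> n n in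
        \<lparr>avec = (\<lambda>x i. if i = n then avec \<alpha> x n + p * avec \<alpha> x (Suc n) / d else avec \<alpha> x i),
         aloop = (\<lambda>k m. if m = n \<and> k \<le> n then 0
                        else if Suc m = n \<and> k < n then aloop \<alpha> k m + p * aloop \<alpha> k n / d
                        else aloop \<alpha> k m)\<rparr>)"

definition calc_loop :: "'s hist \<Rightarrow> alpha \<Rightarrow> (nat \<Rightarrow> real) \<Rightarrow> nat \<Rightarrow> real" where
  "calc_loop h \<alpha> ll k =
     fold (\<lambda>m l. prob_at h m * (l + aloop \<alpha> k m / (1 - ll m))) (rev [Suc k..<length h]) 0
     + aloop \<alpha> k k"

text \<open>All the probability mass of node \<open>k\<close> never terminates. The mass is booked at index \<open>k\<close>, and
  everything that was recorded below \<open>k\<close> is discarded: the loop entries, and also the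
  non-termination entries with index greater than \<open>k\<close>. The published pseudocode clears only the loop
  entries; \<open>cumulate_alpha\<close> then propagates the other part of the mass up to index \<open>k\<close> a second time,
  and the search is incomplete.\<close>

definition mark_noter :: "'s hist \<Rightarrow> nat \<Rightarrow> alpha \<Rightarrow> alpha" where
  "mark_noter h k \<alpha> =
     \<lparr>avec = (avec \<alpha>)(Noter :=
        (\<lambda>i. if i = k then avec \<alpha> Noter k + prob_at h k
             else if k < i then 0 else avec \<alpha> Noter i)),
      aloop = (\<lambda>i j. if k \<le> i \<and> k \<le> j then 0 else aloop \<alpha> i j)\<rparr>"

text \<open>The state of the descending loop consists of the current \<open>\<lambda>\<close>, the vector of loop
  probabilities \<open>\<lambda>\<^sub>l\<^sub>o\<^sub>o\<^sub>p\<close>, and the global variable \<open>\<alpha>\<close>.\<close>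

fun calc_lambda_step ::
  "'s hist \<Rightarrow> nat \<Rightarrow> (kind \<Rightarrow> real) \<times> (nat \<Rightarrow> real) \<times> alpha \<Rightarrow>
     (kind \<Rightarrow> real) \<times> (nat \<Rightarrow> real) \<times> alpha" where
  "calc_lambda_step h k (lam, ll, \<alpha>) =
     (let l = calc_loop h \<alpha> ll k in
      if l + lam Noter = 1 then
        (let \<alpha>' = mark_noter h k \<alpha> in ((\<lambda>x. avec \<alpha>' x k), ll(k := 0), \<alpha>'))
      else ((\<lambda>x. avec \<alpha> x k + prob_at h k * lam x / (1 - l)), ll(k := l), \<alpha>))"

definition calc_lambda :: "'s hist \<Rightarrow> alpha \<Rightarrow> (kind \<Rightarrow> real) \<times> alpha" where
  "calc_lambda h \<alpha> =
     (case fold (calc_lambda_step h) (rev [0..<length h])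
             ((\<lambda>x. avec \<alpha> x (length h)), (\<lambda>k. 0), \<alpha>) of
        (lam, ll, \<alpha>') \<Rightarrow> (lam, \<alpha>'))"

definition next_states ::
  "('s, 'a, 'o) problem \<Rightarrow> 's \<Rightarrow> 'a command \<Rightarrow> ('s node \<times> real) set" where
  "next_states P s c =
     (case c of
        Stop \<Rightarrow> if s \<in> goals P then {(Win, 1)} else {(Fail, 1)}
      | Act a \<Rightarrow> {(State s', p') | s' p'. pmf (delta (env P) s a) s' = p' \<and> p' > 0})"


section \<open>The search\<close>

text \<open>Backtracking search, as the list of the outcomes of the non-deterministic branches in the
  order in which depth-first search meets them. A failing branch contributes no outcome. \<open>Success\<close>
  is an immediate return from the whole search, \<open>Return\<close> an ordinary return of a procedure call, to
  be continued by the caller with the returned controller and the current \<open>\<alpha>\<close>.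

  That the calls do not nest forever holds only for reachable arguments (the pairs \<open>(q, s)\<close> in a
  history are distinct), so the nesting is cut off at a depth \<open>d\<close>. A branch that reaches this depth
  yields \<open>Cutoff\<close>, which is neither a failure nor a result.\<close>

datatype ('o, 'a) outcome =
    Success "('o, 'a) ctrl"
  | Return "('o, 'a) ctrl" alpha
  | Cutoff

definition and_then ::
  "('o, 'a) outcome list \<Rightarrow> (('o, 'a) ctrl \<Rightarrow> alpha \<Rightarrow> ('o, 'a) outcome list) \<Rightarrow>
     ('o, 'a) outcome list" where
  "and_then rs f = concat (map (\<lambda>r. case r of Return C \<alpha> \<Rightarrow> f C \<alpha> | _ \<Rightarrow> [r]) rs)"

text \<open>The order in which the elements of a finite set are processed.\<close>

definition enumerates :: "('x set \<Rightarrow> 'x list) \<Rightarrow> bool" where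
  "enumerates ord \<longleftrightarrow> (\<forall>X. finite X \<longrightarrow> set (ord X) = X \<and> distinct (ord X))"

definition revisits :: "'s hist \<Rightarrow> nat \<Rightarrow> 's \<Rightarrow> nat \<Rightarrow> bool" where
  "revisits h q s k \<longleftrightarrow> k < length h \<and> fst (h ! k) = q \<and> fst (snd (h ! k)) = s"

context
  fixes P :: "('s, 'a, 'o) problem"
    and N :: nat
    and L :: real
    and ord_and :: "('s node \<times> real) set \<Rightarrow> ('s node \<times> real) list"
    and ord_or :: "('a command \<times> nat) set \<Rightarrow> ('a command \<times> nat) list"
begin

function (sequential)
  and_step :: "nat \<Rightarrow> ('o, 'a) ctrl \<Rightarrow> nat \<Rightarrow> ('s node \<times> real) set \<Rightarrow> 's hist \<Rightarrow> alpha \<Rightarrow>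
    ('o, 'a) outcome list" and
  and_loop :: "nat \<Rightarrow> ('o, 'a) ctrl \<Rightarrow> nat \<Rightarrow> ('s node \<times> real) list \<Rightarrow> 's hist \<Rightarrow> alpha \<Rightarrow>
    ('o, 'a) outcome list" and
  or_step :: "nat \<Rightarrow> ('o, 'a) ctrl \<Rightarrow> nat \<Rightarrow> 's node \<Rightarrow> real \<Rightarrow> 's hist \<Rightarrow> alpha \<Rightarrow>
    ('o, 'a) outcome list"
where
  "and_step d C q SP h \<alpha> = and_loop d C q (ord_and SP) h (reset_alpha (length h) \<alpha>)"
| "and_loop d C q [] h \<alpha> = [Return C (cumulate_alpha h \<alpha>)]"
| "and_loop d C q ((x, p) # SP) h \<alpha> =
     and_then (or_step d C q x p h \<alpha>) (\<lambda>C' \<alpha>'.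
       let (lam, \<alpha>'') = calc_lambda h \<alpha>' in
       if lam Goal \<ge> L then [Success C']
       else if 1 - lam Failed - lam Noter < L then []
       else and_loop d C' q SP h \<alpha>'')"
| "or_step 0 C q x p h \<alpha> = [Cutoff]"
| "or_step (Suc d) C q Win p h \<alpha> =
     [Return C (set_avec Goal (length h) (avec \<alpha> Goal (length h) + p) \<alpha>)]"
| "or_step (Suc d) C q Fail p h \<alpha> =
     [Return C (set_avec Failed (length h) (avec \<alpha> Failed (length h) + p) \<alpha>)]"
| "or_step (Suc d) C q (State s) p h \<alpha> =
     (let ob = obs (env P) s in
      if \<exists>k. revisits h q s k then
        (let k = (LEAST k. revisits h q s k); n = length h - 1 in
         if p = 1 \<and> (\<forall>i. k + 1 \<le> i \<and> i \<le> n \<longrightarrow> prob_at h i = 1)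
         then [Return C (set_avec Noter (length h) 1 \<alpha>)]
         else [Return C (set_aloop k n (aloop \<alpha> k n + p) \<alpha>)])
      else
        (case C (q, ob) of
           Some (a, q') \<Rightarrow> and_step d C q' (next_states P s a) (h @ [(q, s, p)]) \<alpha>
         | None \<Rightarrow>
             concat (map (\<lambda>(a, q').
                 and_step d (C((q, ob) \<mapsto> (a, q'))) q' (next_states P s a) (h @ [(q, s, p)]) \<alpha>)
               (ord_or (commands (env P) \<times> {..<N})))))"
  by pat_completeness auto

termination
  by (relation "measures
      [case_sum (\<lambda>(d, _). d) (case_sum (\<lambda>(d, _). d) (\<lambda>(d, _). d)),
       case_sum (\<lambda>_. 2) (case_sum (\<lambda>_. 1) (\<lambda>_. 0)),
       case_sum (\<lambda>_. 0) (case_sum (\<lambda>(_, _, _, SP, _). length SP) (\<lambda>_. 0))]") auto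

definition pandor_synth :: "nat \<Rightarrow> ('o, 'a) outcome list" where
  "pandor_synth d = and_step d Map.empty 0 {(State (init P), 1)} [] alpha_empty"

text \<open>The search returns the first outcome, whatever the outcomes after it are. As no \<open>Cutoff\<close> comes
  before it, all earlier branches have been explored completely.\<close>

definition pandor_returns :: "('o, 'a) ctrl \<Rightarrow> bool" where
  "pandor_returns C \<longleftrightarrow>
     (\<exists>d r rs. pandor_synth d = r # rs \<and> (r = Success C \<or> (\<exists>\<alpha>. r = Return C \<alpha>)))"

end

end

theory Submission
  imports Defs
begin

text \<open>
  Fix a controller \<open>D\<close> that extends the current partial controller. The depth-first search splits the
  unit mass leaving each node of the current history into mass booked as goal, failure,
  non-termination or return to an ancestor, mass sent to the current child, and mass of unexplored
  children. This split is exact, and each booked share is a lower bound for the corresponding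
  probability under \<open>D\<close>, so \<open>\<lambda>\<close> bounds the outcome probabilities of \<open>D\<close> at the initial state from
  below. Taking for \<open>D\<close> the returned controller gives soundness of a success. If \<open>D\<close> is a good total
  controller, then the branch that follows \<open>D\<close> is never pruned. An ordinary return from the whole
  search is impossible: all mass would be booked, so one of the two tests on \<open>\<lambda>\<close> would have fired.
  Since the pairs in a history are distinct, no cutoff happens at a large enough depth.\<close>

subsection \<open>Termination within a bounded number of steps\<close>

text \<open>The delicate case is a node whose recorded return and non-termination mass add up to 1.
  If all of it is return mass, the update of \<open>\<lambda>\<close> would divide by zero, and the
  value equation of the node says nothing. Measured within \<open>T\<close> steps, non-termination
  has value 1 at \<open>T = 0\<close>, and another round through the node preserves this value; so
  the node may be marked. The same total forces goal, failure and unexplored mass below the node,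
  and all returns to earlier nodes, to vanish, so marking discards only non-termination and loop
  entries. This is why conservation of mass is carried along with the lower bounds.

  All claims about an outcome are conditional on its controller being contained in \<open>D\<close>.
  Controllers only grow along a branch, so a branch that has left \<open>D\<close> never comes back
  and drops out of the induction. For completeness one outcome of any kind is enough: returns and
  cutoffs are excluded separately, and every success is sound.\<close>

definition stop_value :: "('s, 'a, 'o) problem \<Rightarrow> kind \<Rightarrow> 's \<Rightarrow> real" where
  "stop_value P x s =
     (case x of Goal \<Rightarrow> of_bool (s \<in> goals P) | Failed \<Rightarrow> of_bool (s \<notin> goals P) | Noter \<Rightarrow> 0)"

text \<open>For \<open>Noter\<close> this is the probability that execution has not stopped during the first \<open>T\<close>
  steps; an undefined label or transition counts as running forever.\<close>

primrec stop_prob ::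
  "('s, 'a, 'o) problem \<Rightarrow> ('q, 'o, 'a) fsc \<Rightarrow> kind \<Rightarrow> nat \<Rightarrow> 'q \<times> 's \<Rightarrow> real" where
  "stop_prob P C x 0 v = of_bool (x = Noter)"
| "stop_prob P C x (Suc T) v =
     (case command_at P C v of
        Some (Act a) \<Rightarrow>
          (case succ_at P C v of
             Some q' \<Rightarrow>
               (\<Sum>s'\<in>states (env P). pmf (delta (env P) (snd v) a) s' * stop_prob P C x T (q', s'))
           | None \<Rightarrow> of_bool (x = Noter))
      | Some Stop \<Rightarrow> stop_value P x (snd v)
      | None \<Rightarrow> of_bool (x = Noter))"

lemma stop_value_nonneg: "stop_value P x s \<ge> 0"
  by (cases x) (auto simp: stop_value_def)

lemma stop_value_sum: "stop_value P Goal s + stop_value P Failed s + stop_value P Noter s = 1"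
  by (auto simp: stop_value_def)

lemma stop_prob_nonneg: "stop_prob P C x T v \<ge> 0"
  by (induction T arbitrary: v)
     (auto simp: stop_value_nonneg split: option.splits command.splits intro!: sum_nonneg)

lemma sum_pmf_le_1: "finite A \<Longrightarrow> (\<Sum>s\<in>A. pmf p s) \<le> 1"
  by (simp flip: measure_measure_pmf_finite)

context
  fixes P :: "('s, 'a, 'o) problem"
  assumes fin: "finite (states (env P))"
begin

text \<open>An inequality, because each step sums over \<open>states (env P)\<close> and this
  context assumes nothing about the support of the transition distributions.\<close>

lemma stop_prob_sum_le_1: "stop_prob P C Goal T v + stop_prob P C Failed T v + stop_prob P C Noter T v \<le> 1"
proof (induction T arbitrary: v)
  case (Suc T)
  have "(\<Sum>s'\<in>states (env P). pmf p s' * stop_prob P C Goal T (q, s')) +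
        (\<Sum>s'\<in>states (env P). pmf p s' * stop_prob P C Failed T (q, s')) +
        (\<Sum>s'\<in>states (env P). pmf p s' * stop_prob P C Noter T (q, s')) \<le> 1" for p q
  proof -
    have "(\<Sum>s'\<in>states (env P). pmf p s' *
        (stop_prob P C Goal T (q, s') + stop_prob P C Failed T (q, s') + stop_prob P C Noter T (q, s')))
      \<le> (\<Sum>s'\<in>states (env P). pmf p s' * 1)"
      by (intro sum_mono mult_left_mono Suc.IH) auto
    also have "\<dots> \<le> 1"
      using fin by (simp add: sum_pmf_le_1)
    finally show ?thesis
      by (simp add: algebra_simps sum.distrib)
  qed
  then show ?case
    using stop_value_sum[of P "snd v"] by (auto split: option.split command.split)
qed auto

lemma stop_prob_le_1: "stop_prob P C x T v \<le> 1"
  using stop_prob_sum_le_1[of C T v] stop_prob_nonneg[of P C Goal T v]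
    stop_prob_nonneg[of P C Failed T v] stop_prob_nonneg[of P C Noter T v]
  by (cases x) auto

lemma stop_prob_Noter_Suc_le: "stop_prob P C Noter (Suc T) v \<le> stop_prob P C Noter T v"
proof (induction T arbitrary: v)
  case 0
  then show ?case
    using stop_prob_le_1[of C Noter "Suc 0" v] by simp
next
  case (Suc T)
  show ?case
    unfolding stop_prob.simps(2)[of P C Noter T v] stop_prob.simps(2)[of P C Noter "Suc T" v]
    by (auto split: option.split command.split simp del: stop_prob.simps
        intro!: sum_mono mult_left_mono Suc.IH)
qed

lemma stop_prob_Suc_ge: "x \<noteq> Noter \<Longrightarrow> stop_prob P C x T v \<le> stop_prob P C x (Suc T) v"
proof (induction T arbitrary: v)
  case 0
  then show ?case
    using stop_prob_nonneg[of P C x "Suc 0" v] by simp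
next
  case (Suc T)
  show ?case
    unfolding stop_prob.simps(2)[of P C x T v] stop_prob.simps(2)[of P C x "Suc T" v]
    using Suc.prems
    by (auto split: option.split command.split simp del: stop_prob.simps
        intro!: sum_mono mult_left_mono Suc.IH)
qed

lemma stop_prob_incseq: "x \<noteq> Noter \<Longrightarrow> incseq (\<lambda>T. stop_prob P C x T v)"
  by (rule incseq_SucI) (rule stop_prob_Suc_ge)

lemma stop_prob_tendsto:
  assumes "x \<noteq> Noter"
  shows "(\<lambda>T. stop_prob P C x T v) \<longlonglongrightarrow> lim (\<lambda>T. stop_prob P C x T v)"
proof -
  have "Bseq (\<lambda>T. stop_prob P C x T v)"
    by (intro BseqI'[where K = 1]) (simp add: stop_prob_le_1 stop_prob_nonneg)
  with stop_prob_incseq[OF assms, of C v] show ?thesis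
    using Bseq_monoseq_convergent incseq_imp_monoseq convergent_LIMSEQ_iff by metis
qed

lemma stop_prob_le_lim:
  assumes "x \<noteq> Noter"
  shows "stop_prob P C x T v \<le> lim (\<lambda>T. stop_prob P C x T v)"
  by (rule incseq_le[OF stop_prob_incseq[OF assms] stop_prob_tendsto[OF assms]])

end

subsection \<open>The likelihood of goal termination as a limit\<close>

definition step :: "('s, 'a, 'o) problem \<Rightarrow> ('q, 'o, 'a) fsc \<Rightarrow> 'q \<times> 's \<Rightarrow> 'q \<times> 's \<Rightarrow> bool" where
  "step P C v v' \<longleftrightarrow> succ_at P C v = Some (fst v') \<and>
     (\<exists>a. command_at P C v = Some (Act a) \<and> pmf (delta (env P) (snd v) a) (snd v') > 0)"

text \<open>The start node is a parameter so that an induction can strip the first node.\<close>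

definition goal_paths :: "('s, 'a, 'o) problem \<Rightarrow> ('q, 'o, 'a) fsc \<Rightarrow> 'q \<times> 's \<Rightarrow> ('q \<times> 's) list set"
  where "goal_paths P C v =
     {h. h \<noteq> [] \<and> hd h = v \<and> set h \<subseteq> cstates C \<times> states (env P) \<and> successively (step P C) h \<and>
         command_at P C (last h) = Some Stop \<and> snd (last h) \<in> goals P}"

lemma goal_histories_eq: "goal_histories P C = goal_paths P C (start C, init P)"
  unfolding goal_histories_def histories_def goal_paths_def successively_conv_nth step_def
  by auto

lemma likelihood_nonneg: "likelihood P C h \<ge> 0"
  unfolding likelihood_def by (intro prod_nonneg) (auto split: option.splits command.splits)

lemma likelihood_Cons:
  assumes "command_at P C v = Some (Act a)" "h \<noteq> []"
  shows "likelihood P C (v # h) = pmf (delta (env P) (snd v) a) (snd (hd h)) * likelihood P C h"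
proof -
  obtain n where n: "length h = Suc n"
    using assms(2) by (cases h) auto
  then show ?thesis
    using assms unfolding likelihood_def list.size n add_0 add_Suc_right add_0_right diff_Suc_1
      prod.lessThan_Suc_shift nth_Cons_Suc nth_Cons_0
    by (simp add: hd_conv_nth)
qed

context
  fixes P :: "('s, 'a, 'o) problem" and C :: "('q, 'o, 'a) fsc"
  assumes fin: "finite (states (env P))" and fsc: "is_fsc (env P) C"
begin

lemma finite_goal_paths_bounded: "finite {h \<in> goal_paths P C v. length h \<le> T}"
proof (rule finite_subset)
  show "{h \<in> goal_paths P C v. length h \<le> T} \<subseteq>
      {h. set h \<subseteq> cstates C \<times> states (env P) \<and> length h \<le> T}"
    unfolding goal_paths_def by auto
  show "finite {h. set h \<subseteq> cstates C \<times> states (env P) \<and> length h \<le> T}"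
    using fin fsc unfolding is_fsc_def by (intro finite_lists_length_le) auto
qed

lemma goal_paths_Stop:
  assumes "command_at P C v = Some Stop" "v \<in> cstates C \<times> states (env P)"
  shows "goal_paths P C v = (if snd v \<in> goals P then {[v]} else {})"
proof -
  have "h = [v]" if "h \<in> goal_paths P C v" for h
  proof (cases h)
    case (Cons w h')
    then show ?thesis
      using that assms(1) unfolding goal_paths_def
      by (cases h') (auto simp: step_def)
  qed (use that in \<open>simp add: goal_paths_def\<close>)
  moreover have "[v] \<in> goal_paths P C v \<longleftrightarrow> snd v \<in> goals P"
    using assms by (auto simp: goal_paths_def)
  ultimately show ?thesis
    by auto
qed

lemma goal_paths_Act:
  assumes "command_at P C v = Some (Act a)" "succ_at P C v = Some q'"
    and "v \<in> cstates C \<times> states (env P)"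
  shows "goal_paths P C v =
    (\<Union>s'\<in>{s' \<in> states (env P). pmf (delta (env P) (snd v) a) s' > 0}. (#) v ` goal_paths P C (q', s'))"
    (is "_ = ?R")
proof (intro equalityI subsetI)
  fix h assume h: "h \<in> goal_paths P C v"
  then obtain h' where h': "h = v # h'"
    by (cases h) (auto simp: goal_paths_def)
  have "h' \<noteq> []"
    using h h' assms(1) by (auto simp: goal_paths_def)
  then obtain w h'' where w: "h' = w # h''"
    by (cases h') auto
  have "step P C v w" "w \<in> cstates C \<times> states (env P)"
    using h h' w by (auto simp: goal_paths_def)
  moreover from this have "w = (q', snd w)"
    using assms(2) by (auto simp: step_def prod_eq_iff)
  moreover have "h' \<in> goal_paths P C w"
    using h h' w by (auto simp: goal_paths_def)
  ultimately show "h \<in> ?R"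
    using assms(1) h' by (auto simp: step_def intro!: bexI[of _ "snd w"])
next
  fix h assume "h \<in> ?R"
  then obtain s' h' where "s' \<in> states (env P)" "pmf (delta (env P) (snd v) a) s' > 0"
    and "h' \<in> goal_paths P C (q', s')" "h = v # h'"
    by auto
  then show "h \<in> goal_paths P C v"
    using assms by (cases h') (auto simp: goal_paths_def step_def)
qed

lemma goal_paths_stuck:
  assumes "command_at P C v = None \<or> (\<exists>a. command_at P C v = Some (Act a)) \<and> succ_at P C v = None"
  shows "goal_paths P C v = {}"
proof -
  have False if "h \<in> goal_paths P C v" for h
  proof (cases h)
    case (Cons w h')
    then show ?thesis
      using that assms unfolding goal_paths_def
      by (cases h') (auto simp: step_def)
  qed (use that in \<open>simp add: goal_paths_def\<close>)
  then show ?thesis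
    by auto
qed

text \<open>A path of length at most \<open>T\<close> issues at most \<open>T\<close> commands, the
  final stop included. Splitting a path into head and tail therefore matches the recursion of
  \<open>stop_prob\<close>.\<close>

lemma sum_goal_paths:
  assumes "v \<in> cstates C \<times> states (env P)"
  shows "(\<Sum>h | h \<in> goal_paths P C v \<and> length h \<le> T. likelihood P C h) = stop_prob P C Goal T v"
  using assms
proof (induction T arbitrary: v)
  case 0
  have "{h. h \<in> goal_paths P C v \<and> length h \<le> 0} = {}"
    by (auto simp: goal_paths_def)
  then show ?case
    by (simp only: sum.empty stop_prob.simps) simp
next
  case (Suc T)
  show ?case
  proof (cases "command_at P C v")
    case None
    then show ?thesis
      using goal_paths_stuck[of v] by simp
  next
    case (Some c)
    show ?thesis
    proof (cases c)
      case Stop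
      have "{h. h \<in> goal_paths P C v \<and> length h \<le> Suc T} = (if snd v \<in> goals P then {[v]} else {})"
        using goal_paths_Stop[of v] Some Stop Suc.prems by auto
      then show ?thesis
        using Some Stop by (simp add: stop_value_def likelihood_def)
    next
      case (Act a)
      show ?thesis
      proof (cases "succ_at P C v")
        case None
        then show ?thesis
          using goal_paths_stuck[of v] Some Act by simp
      next
        case q': (Some q')
        let ?p = "\<lambda>s'. pmf (delta (env P) (snd v) a) s'"
        let ?S = "{s' \<in> states (env P). ?p s' > 0}"
        let ?H = "\<lambda>s'. {h. h \<in> goal_paths P C (q', s') \<and> length h \<le> T}"
        have "fst v \<in> cstates C" "q' \<in> cstates C"
          using Suc.prems q' fsc ranI[of "succ C"]
          by (fastforce simp: is_fsc_def succ_at_def split: prod.splits)+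
        then have IH: "(\<Sum>h\<in>?H s'. likelihood P C h) = stop_prob P C Goal T (q', s')"
          if "s' \<in> states (env P)" for s'
          using Suc.IH[of "(q', s')"] that by auto
        have "{h. h \<in> goal_paths P C v \<and> length h \<le> Suc T} = (\<Union>s'\<in>?S. (#) v ` ?H s')"
          using goal_paths_Act[of v a q'] Some Act q' Suc.prems by auto
        also have "(\<Sum>h\<in>\<dots>. likelihood P C h) = (\<Sum>s'\<in>?S. \<Sum>h\<in>(#) v ` ?H s'. likelihood P C h)"
        proof (rule sum.UNION_disjoint)
          show "finite ?S"
            using fin by simp
          show "\<forall>s'\<in>?S. finite ((#) v ` ?H s')"
            using finite_goal_paths_bounded by simp
          show "\<forall>i\<in>?S. \<forall>j\<in>?S. i \<noteq> j \<longrightarrow> (#) v ` ?H i \<inter> (#) v ` ?H j = {}"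
            by (auto simp: goal_paths_def)
        qed
        also have "\<dots> = (\<Sum>s'\<in>?S. \<Sum>h\<in>?H s'. likelihood P C (v # h))"
          by (intro sum.cong sum.reindex_cong[of "(#) v"]) auto
        also have "\<dots> = (\<Sum>s'\<in>?S. \<Sum>h\<in>?H s'. ?p s' * likelihood P C h)"
          by (intro sum.cong refl) (auto simp: goal_paths_def likelihood_Cons Some Act)
        also have "\<dots> = (\<Sum>s'\<in>?S. ?p s' * stop_prob P C Goal T (q', s'))"
          by (intro sum.cong refl) (simp add: IH flip: sum_distrib_left)
        also have "\<dots> = (\<Sum>s'\<in>states (env P). ?p s' * stop_prob P C Goal T (q', s'))"
          using fin by (intro sum.mono_neutral_left) (auto simp: pmf_nonneg less_le)
        finally show ?thesis
          using Some Act q' by simp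
      qed
    qed
  qed
qed

text \<open>The lengths in a finite set of histories are bounded. Together with
  \<open>stop_prob_le_LGT\<close> this makes \<open>LGT\<close> the supremum of the bounded-time
  goal probabilities, and infinite sums no longer occur afterwards.\<close>

lemma sum_likelihood_le:
  assumes "init P \<in> states (env P)" "finite F" "F \<subseteq> goal_histories P C"
  shows "\<exists>T. sum (likelihood P C) F \<le> stop_prob P C Goal T (start C, init P)"
proof -
  let ?T = "Max (insert 0 (length ` F))"
  have v: "(start C, init P) \<in> cstates C \<times> states (env P)"
    using assms(1) fsc by (simp add: is_fsc_def)
  have "length h \<le> ?T" if "h \<in> F" for h
    using assms(2) that by (intro Max_ge) auto
  then have "sum (likelihood P C) F \<le>
      (\<Sum>h | h \<in> goal_paths P C (start C, init P) \<and> length h \<le> ?T. likelihood P C h)"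
    using assms(3) finite_goal_paths_bounded
    by (intro sum_mono2) (auto simp: goal_histories_eq likelihood_nonneg)
  then show ?thesis
    using sum_goal_paths[OF v] by auto
qed

lemma LGT_summable:
  assumes "init P \<in> states (env P)"
  shows "likelihood P C summable_on goal_histories P C"
proof (rule nonneg_bdd_above_summable_on)
  show "bdd_above (sum (likelihood P C) ` {F. F \<subseteq> goal_histories P C \<and> finite F})"
  proof (rule bdd_aboveI2)
    fix F assume "F \<in> {F. F \<subseteq> goal_histories P C \<and> finite F}"
    then obtain T where "sum (likelihood P C) F \<le> stop_prob P C Goal T (start C, init P)"
      using sum_likelihood_le[OF assms] by blast
    also have "\<dots> \<le> 1"
      by (rule stop_prob_le_1[OF fin])
    finally show "sum (likelihood P C) F \<le> 1" .
  qed
qed (rule likelihood_nonneg)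

lemma stop_prob_le_LGT:
  assumes "init P \<in> states (env P)"
  shows "stop_prob P C Goal T (start C, init P) \<le> LGT P C"
proof -
  have v: "(start C, init P) \<in> cstates C \<times> states (env P)"
    using assms(1) fsc by (simp add: is_fsc_def)
  show ?thesis
    unfolding LGT_def sum_goal_paths[OF v, symmetric]
    using LGT_summable[OF assms] finite_goal_paths_bounded
    by (intro finite_sum_le_infsum) (auto simp: goal_histories_eq likelihood_nonneg)
qed

lemma LGT_le:
  assumes "init P \<in> states (env P)" "\<And>T. stop_prob P C Goal T (start C, init P) \<le> b"
  shows "LGT P C \<le> b"
  unfolding LGT_def
proof (rule infsum_le_finite_sums[OF LGT_summable[OF assms(1)]])
  fix F assume "finite F" "F \<subseteq> goal_histories P C"
  then obtain T where "sum (likelihood P C) F \<le> stop_prob P C Goal T (start C, init P)"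
    using sum_likelihood_le[OF assms(1)] by blast
  also have "\<dots> \<le> b"
    by (rule assms(2))
  finally show "sum (likelihood P C) F \<le> b" .
qed

end

subsection \<open>The invariant of the bookkeeping\<close>

definition mass :: "alpha \<Rightarrow> nat \<Rightarrow> real" where
  "mass \<alpha> j = avec \<alpha> Goal j + avec \<alpha> Failed j + avec \<alpha> Noter j + (\<Sum>i<j. aloop \<alpha> i (j - 1))"

definition child :: "'s hist \<Rightarrow> nat \<Rightarrow> nat \<Rightarrow> real" where
  "child h \<kappa> j = (if j < \<kappa> then prob_at h j else 0)"

definition back_prob :: "'s hist \<Rightarrow> alpha \<Rightarrow> (nat \<Rightarrow> real) \<Rightarrow> nat \<Rightarrow> nat \<Rightarrow> real" where
  "back_prob h \<alpha> ll i j =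
     fold (\<lambda>m l. prob_at h m * (l + aloop \<alpha> i m / (1 - ll m))) (rev [j..<length h]) 0"

definition ret_prob :: "'s hist \<Rightarrow> alpha \<Rightarrow> (nat \<Rightarrow> real) \<Rightarrow> nat \<Rightarrow> nat \<Rightarrow> real" where
  "ret_prob h \<alpha> ll i j = back_prob h \<alpha> ll i j + aloop \<alpha> i (j - 1)"

lemma calc_loop_eq: "calc_loop h \<alpha> ll k = ret_prob h \<alpha> ll k (Suc k)"
  by (simp add: calc_loop_def ret_prob_def back_prob_def)

lemma back_prob_end: "length h \<le> j \<Longrightarrow> back_prob h \<alpha> ll i j = 0"
  by (simp add: back_prob_def)

lemma back_prob_rec:
  "j < length h \<Longrightarrow>
    back_prob h \<alpha> ll i j = prob_at h j * (back_prob h \<alpha> ll i (Suc j) + aloop \<alpha> i j / (1 - ll j))"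
  by (simp add: back_prob_def upt_conv_Cons)

lemma back_prob_cong:
  "(\<And>m. j \<le> m \<Longrightarrow> ll m = ll' m) \<Longrightarrow> back_prob h \<alpha> ll i j = back_prob h \<alpha> ll' i j"
  unfolding back_prob_def by (intro fold_cong) auto

lemma back_prob_zero:
  assumes "\<And>m. j \<le> m \<Longrightarrow> m < length h \<Longrightarrow> aloop \<alpha> i m = 0"
  shows "back_prob h \<alpha> ll i j = 0"
proof (cases "j \<le> length h")
  case True
  then show ?thesis
    using assms
  proof (induction j rule: inc_induct)
    case (step j)
    then show ?case
      by (simp add: back_prob_rec)
  qed (simp add: back_prob_end)
qed (simp add: back_prob_end)

lemma back_prob_nonneg:
  assumes "\<And>m. 0 \<le> aloop \<alpha> i m" "\<And>m. m < length h \<Longrightarrow> 0 < prob_at h m"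
    and "\<And>m. j \<le> m \<Longrightarrow> m < length h \<Longrightarrow> ll m < 1"
  shows "back_prob h \<alpha> ll i j \<ge> 0"
proof (cases "j \<le> length h")
  case True
  then show ?thesis
    using assms(3)
  proof (induction j rule: inc_induct)
    case (step j)
    then have "0 \<le> back_prob h \<alpha> ll i (Suc j)" "ll j < 1" "0 < prob_at h j"
      using assms(2) by auto
    then show ?case
      using assms(1)[of j] step.hyps by (simp add: back_prob_rec)
  qed (simp add: back_prob_end)
qed (simp add: back_prob_end)

text \<open>All weights in the fold are positive, so a vanishing total leaves no summand. Marking a
  node relies on this to see that no return to an earlier node is recorded.\<close>

lemma back_prob_eq_0D:
  assumes "\<And>m. 0 \<le> aloop \<alpha> i m" "\<And>m. m < length h \<Longrightarrow> 0 < prob_at h m"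
    and "\<And>m. j \<le> m \<Longrightarrow> m < length h \<Longrightarrow> ll m < 1"
    and "back_prob h \<alpha> ll i j = 0" "j \<le> m" "m < length h"
  shows "aloop \<alpha> i m = 0"
proof -
  have "j \<le> length h"
    using assms(5,6) by simp
  then show ?thesis
    using assms(3-5)
  proof (induction j rule: inc_induct)
    case (step j)
    have nn: "0 \<le> back_prob h \<alpha> ll i (Suc j)"
      using assms(1,2) step.prems by (intro back_prob_nonneg) auto
    have "ll j < 1" "0 < prob_at h j"
      using step assms(2) by auto
    then have "back_prob h \<alpha> ll i (Suc j) + aloop \<alpha> i j / (1 - ll j) = 0"
      using step.prems(2) step.hyps(2) by (simp add: back_prob_rec)
    then have "back_prob h \<alpha> ll i (Suc j) = 0 \<and> aloop \<alpha> i j / (1 - ll j) = 0"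
      using nn assms(1)[of j] \<open>ll j < 1\<close> by (simp add: add_nonneg_eq_0_iff)
    then show ?case
      using step \<open>ll j < 1\<close> by (cases "m = j") auto
  qed (use assms(6) in simp)
qed

text \<open>\<open>u x T v\<close> stands for the probability of outcome \<open>x\<close> from \<open>v\<close>; for \<open>Noter\<close>, of not having stopped
  within \<open>T\<close> steps. The parameter \<open>T\<close> is needed for nodes that return to themselves with probability
  1: there the fixpoint equation of the limit is void, but induction on \<open>T\<close> still gives the value 1.\<close>

locale value_family =
  fixes root :: "nat \<times> 's" and u :: "kind \<Rightarrow> nat \<Rightarrow> nat \<times> 's \<Rightarrow> real"
  assumes u_nonneg: "0 \<le> u x T v"
    and u_antitone: "u x (Suc T) v \<le> u x T v"
    and u_Noter_0: "u Noter 0 v = 1"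
begin

text \<open>Index \<open>j\<close> stands for node \<open>j - 1\<close>; the virtual node at 0
  enters the root in one step, hence \<open>T - 1\<close>. In \<open>invariant\<close> the current
  child is evaluated at the same \<open>Suc T\<close> as its parent, and only a booked return lowers
  the index to \<open>T\<close>. By antitonicity this is weaker than the one-step equation, but it
  makes a round through a loop cost one step whatever its length.\<close>

definition w :: "'s hist \<Rightarrow> kind \<Rightarrow> nat \<Rightarrow> nat \<Rightarrow> real" where
  "w h x T j =
     (if j = 0 then u x (T - 1) root else u x T (fst (h ! (j - 1)), fst (snd (h ! (j - 1)))))"

lemma w_nonneg: "0 \<le> w h x T j"
  by (simp add: w_def u_nonneg)

lemma w_antitone: "w h x (Suc T) j \<le> w h x T j"
  using u_antitone[of x "T - 1" root] by (cases T) (simp_all add: w_def u_antitone)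

lemma w_append: "j \<le> length h \<Longrightarrow> w (h @ [v]) x T j = w h x T j"
  by (cases j) (simp_all add: w_def nth_append)

lemma w_snoc: "w (h @ [(q, s, p)]) x T (Suc (length h)) = u x T (q, s)"
  by (simp add: w_def)

lemma w_Noter_eq_1:
  assumes "\<And>T. w h Noter T j \<ge> 1 \<Longrightarrow> w h Noter (Suc T) j \<ge> 1"
  shows "w h Noter T j \<ge> 1"
proof (induction T)
  case 0
  then show ?case
    by (simp add: w_def u_Noter_0)
qed (rule assms)

text \<open>Level \<open>j\<close> of the bookkeeping consists of the entries \<open>\<alpha>\<^sub>x\<close> at \<open>j\<close> and of column \<open>j - 1\<close> of
  the loop matrix. It splits the unit mass that leaves node \<open>j - 1\<close> of the history (at level 0, a
  virtual predecessor of the initial node): part of it is booked, \<open>prob_at h j\<close> goes to the child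
  that is currently explored, and \<open>r j\<close> to the children that have not been explored yet, which
  contribute at least \<open>\<rho> j\<close> to the value of the node. Marking node \<open>\<kappa>\<close> as non-terminating books the
  mass of the current child of level \<open>\<kappa>\<close> and leaves nothing at the levels above \<open>\<kappa>\<close>; before any
  marking, \<open>\<kappa> = length h\<close>.\<close>

definition invariant ::
  "'s hist \<Rightarrow> alpha \<Rightarrow> (nat \<Rightarrow> real) \<Rightarrow> (nat \<Rightarrow> kind \<Rightarrow> nat \<Rightarrow> real) \<Rightarrow> nat \<Rightarrow> bool" where
  "invariant h \<alpha> r \<rho> \<kappa> \<longleftrightarrow>
     \<kappa> \<le> length h \<and>
     (\<forall>x j. 0 \<le> avec \<alpha> x j) \<and> (\<forall>i m. 0 \<le> aloop \<alpha> i m) \<and>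
     (\<forall>j<length h. 0 < prob_at h j) \<and>
     (\<forall>j\<le>length h. 0 \<le> r j) \<and> (\<forall>j\<le>length h. \<forall>x T. 0 \<le> \<rho> j x T) \<and>
     (\<forall>i\<le>length h. aloop \<alpha> i (length h) = 0) \<and>
     (\<forall>j\<le>\<kappa>. mass \<alpha> j + child h \<kappa> j + r j = 1) \<and>
     (\<forall>j. \<kappa> < j \<longrightarrow> j \<le> length h \<longrightarrow>
        r j = 0 \<and> (\<forall>x. avec \<alpha> x j = 0) \<and> (\<forall>i<j. aloop \<alpha> i (j - 1) = 0)) \<and>
     (\<forall>j\<le>\<kappa>. \<forall>x T.
        avec \<alpha> x j + (\<Sum>i<j. aloop \<alpha> i (j - 1) * w h x T (Suc i)) +
          child h \<kappa> j * w h x (Suc T) (Suc j) + \<rho> j x T \<le> w h x (Suc T) j)"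

lemma invariantD:
  assumes "invariant h \<alpha> r \<rho> \<kappa>"
  shows "\<kappa> \<le> length h"
    and "0 \<le> avec \<alpha> x j" and "0 \<le> aloop \<alpha> i m"
    and "j < length h \<Longrightarrow> 0 < prob_at h j"
    and "j \<le> length h \<Longrightarrow> 0 \<le> r j"
    and "j \<le> length h \<Longrightarrow> 0 \<le> \<rho> j x T"
    and "i \<le> length h \<Longrightarrow> aloop \<alpha> i (length h) = 0"
    and "j \<le> \<kappa> \<Longrightarrow> mass \<alpha> j + child h \<kappa> j + r j = 1"
    and "\<kappa> < j \<Longrightarrow> j \<le> length h \<Longrightarrow> r j = 0"
    and "\<kappa> < j \<Longrightarrow> j \<le> length h \<Longrightarrow> avec \<alpha> x j = 0"
    and "\<kappa> < j \<Longrightarrow> j \<le> length h \<Longrightarrow> i < j \<Longrightarrow> aloop \<alpha> i (j - 1) = 0"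
    and "j \<le> \<kappa> \<Longrightarrow>
      avec \<alpha> x j + (\<Sum>i<j. aloop \<alpha> i (j - 1) * w h x T (Suc i)) +
        child h \<kappa> j * w h x (Suc T) (Suc j) + \<rho> j x T \<le> w h x (Suc T) j"
  using assms unfolding invariant_def by simp_all

lemma invariant_cong:
  assumes "invariant h \<alpha> r \<rho> \<kappa>"
    and "\<And>j. j \<le> length h \<Longrightarrow> r j = r' j" "\<And>j. j \<le> length h \<Longrightarrow> \<rho> j = \<rho>' j"
  shows "invariant h \<alpha> r' \<rho>' \<kappa>"
proof -
  have "j \<le> length h" if "j \<le> \<kappa>" for j
    using that invariantD(1)[OF assms(1)] by simp
  then show ?thesis
    using assms unfolding invariant_def by auto
qed

text \<open>Marking leaves no unexplored mass at the levels above the marked one, so unexplored mass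
  at the last level excludes a marking.\<close>

lemma invariant_alive:
  assumes "invariant h \<alpha> r \<rho> \<kappa>" "0 < r (length h)"
  shows "\<kappa> = length h"
  using invariantD(1)[OF assms(1)] invariantD(9)[OF assms(1), of "length h"] assms(2) by force

subsection \<open>The lower bounds computed from the bookkeeping\<close>

text \<open>\<open>calc_loop\<close> divides only the direct return mass of a node by \<open>1 - ll m\<close>, not the mass that comes
  from its descendants. So it underestimates the return probability except at the last node, and
  the mass bound below is an inequality. The slack \<open>q\<close> accounts for unexplored children: if a node
  is marked as non-terminating, then \<open>q = 0\<close> and nothing below it is left to explore.\<close>

definition stage ::
  "'s hist \<Rightarrow> (nat \<Rightarrow> real) \<Rightarrow> (nat \<Rightarrow> kind \<Rightarrow> nat \<Rightarrow> real) \<Rightarrow> nat \<Rightarrow>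
    (kind \<Rightarrow> real) \<times> (nat \<Rightarrow> real) \<times> alpha \<Rightarrow> bool" where
  "stage h r \<rho> j = (\<lambda>(lam, ll, \<alpha>).
     (\<exists>\<kappa>. invariant h \<alpha> r \<rho> \<kappa> \<and> (\<kappa> < j \<longrightarrow> (\<forall>x. lam x = 0))) \<and>
     (\<forall>x. 0 \<le> lam x) \<and> (\<forall>m. j \<le> m \<longrightarrow> m < length h \<longrightarrow> ll m < 1 \<and> 0 \<le> ll m) \<and>
     (\<forall>x T. lam x + (\<Sum>i<j. ret_prob h \<alpha> ll i j * w h x T (Suc i)) \<le> w h x (Suc T) j) \<and>
     (\<exists>q\<ge>0. lam Goal + lam Failed + lam Noter + (\<Sum>i<j. ret_prob h \<alpha> ll i j) + q \<le> 1 \<and>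
        (q = 0 \<longrightarrow> (\<forall>i. j \<le> i \<longrightarrow> i \<le> length h \<longrightarrow> r i = 0))) \<and>
     (\<forall>x. x \<noteq> Noter \<longrightarrow> lam x = 0 \<longrightarrow> (\<forall>i. j \<le> i \<longrightarrow> i \<le> length h \<longrightarrow> avec \<alpha> x i = 0)) \<and>
     (j < length h \<longrightarrow> aloop \<alpha> (length h - 1) (length h - 1) < 1))"

text \<open>No mass passes below level \<open>j\<close>, so the booked entries alone are valid
  bounds. This starts the descending loop at \<open>length h\<close> and restarts it after a
  marking.\<close>

lemma stage_dead:
  assumes inv: "invariant h \<alpha> r \<rho> \<kappa>" and j: "\<kappa> \<le> j" "j \<le> length h"
    and ll: "\<And>m. j \<le> m \<Longrightarrow> m < length h \<Longrightarrow> ll m < 1 \<and> 0 \<le> ll m"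
  shows "stage h r \<rho> j ((\<lambda>x. avec \<alpha> x j), ll, \<alpha>)"
proof -
  note D = invariantD[OF inv]
  have back_prob: "back_prob h \<alpha> ll i j = 0" if "i < j" for i
  proof (rule back_prob_zero)
    fix m assume "j \<le> m" "m < length h"
    then show "aloop \<alpha> i m = 0"
      using D(11)[of "Suc m" i] j that by simp
  qed
  then have ret_prob: "ret_prob h \<alpha> ll i j = aloop \<alpha> i (j - 1)" if "i < j" for i
    using that by (simp add: ret_prob_def)
  have zero: "avec \<alpha> x i = 0 \<and> r i = 0" if "j < i" "i \<le> length h" for x i
    using D(9)[of i] D(10)[of i] that j by simp
  have "avec \<alpha> x j + (\<Sum>i<j. ret_prob h \<alpha> ll i j * w h x T (Suc i)) \<le> w h x (Suc T) j" for x T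
  proof (cases "\<kappa> = j")
    case True
    then show ?thesis
      using D(12)[of j x T] D(6)[of j x T] j by (simp add: ret_prob child_def cong: sum.cong_simp)
  next
    case False
    then show ?thesis
      using D(10)[of j] D(11)[of j] j by (simp add: ret_prob w_nonneg cong: sum.cong_simp)
  qed
  moreover have
    "avec \<alpha> Goal j + avec \<alpha> Failed j + avec \<alpha> Noter j + (\<Sum>i<j. ret_prob h \<alpha> ll i j) + r j \<le> 1"
  proof (cases "\<kappa> = j")
    case True
    then show ?thesis
      using D(8)[of j] by (simp add: ret_prob child_def mass_def cong: sum.cong_simp)
  next
    case False
    then show ?thesis
      using D(9)[of j] D(10)[of j] D(11)[of j] j by (simp add: ret_prob cong: sum.cong_simp)
  qed
  moreover have "r j = 0 \<Longrightarrow> j \<le> i \<Longrightarrow> i \<le> length h \<Longrightarrow> r i = 0" for i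
    using zero[of i] by (cases "i = j") auto
  moreover have "avec \<alpha> x j = 0 \<Longrightarrow> j \<le> i \<Longrightarrow> i \<le> length h \<Longrightarrow> avec \<alpha> x i = 0" for x i
    using zero[of i] by (cases "i = j") auto
  moreover have "aloop \<alpha> (length h - 1) (length h - 1) < 1" if "j < length h"
    using D(11)[of "length h" "length h - 1"] that j by simp
  moreover have "\<kappa> < j \<Longrightarrow> avec \<alpha> x j = 0" for x
    using D(10)[of j] j by simp
  ultimately show ?thesis
    using inv ll D(2) D(5)[OF j(2)] unfolding stage_def prod.case by blast
qed

lemma mark_noter_simps:
  "avec (mark_noter h k \<alpha>) x i =
    (if x = Noter then if i = k then avec \<alpha> Noter k + prob_at h k
                       else if k < i then 0 else avec \<alpha> Noter i
     else avec \<alpha> x i)"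
  "aloop (mark_noter h k \<alpha>) i j = (if k \<le> i \<and> k \<le> j then 0 else aloop \<alpha> i j)"
  by (simp_all add: mark_noter_def)

text \<open>As node \<open>k\<close> never stops, the mass of the current child of level
  \<open>k\<close> can move to the non-termination entry without changing the total or violating the
  bound. The assumptions \<open>zero\<close> cover the unexplored mass and those entries above level
  \<open>k\<close> that \<open>mark_noter\<close> does not clear.\<close>

lemma invariant_mark:
  assumes inv: "invariant h \<alpha> r \<rho> \<kappa>" and k: "k < \<kappa>"
    and dead: "\<And>T. w h Noter T (Suc k) \<ge> 1"
    and zero: "\<And>j x. k < j \<Longrightarrow> j \<le> length h \<Longrightarrow> x \<noteq> Noter \<Longrightarrow> avec \<alpha> x j = 0"
      "\<And>j. k < j \<Longrightarrow> j \<le> length h \<Longrightarrow> r j = 0"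
      "\<And>i m. i < k \<Longrightarrow> k \<le> m \<Longrightarrow> m < length h \<Longrightarrow> aloop \<alpha> i m = 0"
  shows "invariant h (mark_noter h k \<alpha>) r \<rho> k"
proof -
  note D = invariantD[OF inv]
  define \<alpha>' where "\<alpha>' = mark_noter h k \<alpha>"
  note avec' = mark_noter_simps(1)[of h k \<alpha>, folded \<alpha>'_def]
  note aloop' = mark_noter_simps(2)[of h k \<alpha>, folded \<alpha>'_def]
  have kh: "k < length h"
    using k D(1) by simp
  have loops: "(\<Sum>i<j. aloop \<alpha>' i (j - 1) * f i) = (\<Sum>i<j. aloop \<alpha> i (j - 1) * f i)"
    if "j \<le> k" for j and f :: "nat \<Rightarrow> real"
    using that by (intro sum.cong) (auto simp: avec' aloop')
  have loops1: "(\<Sum>i<j. aloop \<alpha>' i (j - 1)) = (\<Sum>i<j. aloop \<alpha> i (j - 1))" if "j \<le> k" for j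
    using loops[OF that, of "\<lambda>_. 1"] by simp
  have mass: "mass \<alpha>' j + child h k j + r j = 1" if "j \<le> k" for j
    using D(8)[of j] that k loops1[OF that] by (auto simp: mass_def child_def avec')
  have low: "avec \<alpha>' x j + (\<Sum>i<j. aloop \<alpha>' i (j - 1) * w h x T (Suc i)) +
      child h k j * w h x (Suc T) (Suc j) + \<rho> j x T \<le> w h x (Suc T) j" if j: "j \<le> k" for j x T
  proof (cases "j = k")
    case True
    have "prob_at h k * 1 \<le> prob_at h k * w h Noter (Suc T) (Suc k)"
      using dead D(4)[OF kh] by (intro mult_left_mono) auto
    moreover have "0 \<le> prob_at h k * w h x (Suc T) (Suc k)"
      using D(4)[OF kh] w_nonneg by simp
    ultimately show ?thesis
      using D(12)[of k x T] True k loops[OF j] by (auto simp: child_def avec' aloop')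
  next
    case False
    then show ?thesis
      using D(12)[of j x T] j k loops[OF j] by (auto simp: child_def avec')
  qed
  have above: "r j = 0 \<and> (\<forall>x. avec \<alpha>' x j = 0) \<and> (\<forall>i<j. aloop \<alpha>' i (j - 1) = 0)"
    if "k < j" "j \<le> length h" for j
  proof -
    have "aloop \<alpha>' i (j - 1) = 0" if "i < j" for i
      using zero(3)[of i "j - 1"] that \<open>k < j\<close> \<open>j \<le> length h\<close> by (auto simp: avec' aloop')
    then show ?thesis
      using zero(1,2)[OF that] that by (auto simp: avec' aloop')
  qed
  have "0 \<le> avec \<alpha>' x j" for x j
    using D(2)[of x j] D(2)[of Noter j] D(2)[of Noter k] D(4)[OF kh] by (simp add: avec')
  moreover have "0 \<le> aloop \<alpha>' i m" for i m
    using D(3)[of i m] by (simp add: avec' aloop')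
  moreover have "aloop \<alpha>' i (length h) = 0" if "i \<le> length h" for i
    using D(7)[OF that] by (simp add: avec' aloop')
  ultimately show ?thesis
    using mass low above D(4,5,6) kh unfolding invariant_def \<alpha>'_def[symmetric] by simp
qed

lemma stage_step:
  assumes st: "stage h r \<rho> (Suc k) (lam, ll, \<alpha>)" and k: "k < length h"
  shows "stage h r \<rho> k (calc_lambda_step h k (lam, ll, \<alpha>))"
proof -
  define l where "l = ret_prob h \<alpha> ll k (Suc k)"
  define p where "p = prob_at h k"
  note st = st[unfolded stage_def prod.case]
  from st obtain \<kappa> where inv: "invariant h \<alpha> r \<rho> \<kappa>" and dead: "\<kappa> < Suc k \<longrightarrow> (\<forall>x. lam x = 0)"
    by (elim conjE exE)
  from st obtain q where q: "0 \<le> q"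
      "lam Goal + lam Failed + lam Noter + (\<Sum>i<Suc k. ret_prob h \<alpha> ll i (Suc k)) + q \<le> 1"
      "q = 0 \<longrightarrow> (\<forall>i. Suc k \<le> i \<longrightarrow> i \<le> length h \<longrightarrow> r i = 0)"
    by (elim conjE exE)
  from st have lam: "0 \<le> lam x"
    and ll: "Suc k \<le> m \<Longrightarrow> m < length h \<Longrightarrow> ll m < 1 \<and> 0 \<le> ll m"
    and low: "lam x + (\<Sum>i<Suc k. ret_prob h \<alpha> ll i (Suc k) * w h x T (Suc i)) \<le> w h x (Suc T) (Suc k)"
    and gf: "x \<noteq> Noter \<Longrightarrow> lam x = 0 \<Longrightarrow> Suc k \<le> i \<Longrightarrow> i \<le> length h \<Longrightarrow> avec \<alpha> x i = 0"
    and tip: "Suc k < length h \<Longrightarrow> aloop \<alpha> (length h - 1) (length h - 1) < 1"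
    for x m T i
    by simp_all
  note D = invariantD[OF inv]
  have p: "0 < p"
    using D(4) k by (simp add: p_def)
  have back_nn: "0 \<le> back_prob h \<alpha> ll i (Suc k)" for i
    using D(3,4) ll by (intro back_prob_nonneg) auto
  have ret_nn: "0 \<le> ret_prob h \<alpha> ll i (Suc k)" for i
    using back_nn[of i] D(3) by (simp add: ret_prob_def)
  have l: "0 \<le> l"
    using ret_nn by (simp add: l_def)
  define R where "R = (\<Sum>i<k. ret_prob h \<alpha> ll i (Suc k))"
  have R: "0 \<le> R"
    unfolding R_def by (intro sum_nonneg ret_nn)
  have total: "lam Goal + lam Failed + lam Noter + R + l + q \<le> 1"
    using q(2) by (simp add: R_def l_def)
  show ?thesis
  proof (cases "\<kappa> \<le> k")
    \<comment> \<open>A marking at or before node \<open>k\<close> has emptied the levels above it.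
      Both \<open>lam\<close> and the return mass are 0, so the test cannot fire again.\<close>
    case True
    have "back_prob h \<alpha> ll k (Suc k) = 0"
    proof (rule back_prob_zero)
      fix m assume "Suc k \<le> m" "m < length h"
      then show "aloop \<alpha> k m = 0"
        using D(11)[of "Suc m" k] True by simp
    qed
    moreover have "aloop \<alpha> k k = 0"
      using D(11)[of "Suc k" k] True k by simp
    ultimately have "l = 0"
      by (simp add: l_def ret_prob_def)
    then have "calc_lambda_step h k (lam, ll, \<alpha>) = ((\<lambda>x. avec \<alpha> x k), ll(k := 0), \<alpha>)"
      using dead True by (simp add: calc_loop_eq flip: l_def)
    then show ?thesis
      using stage_dead[OF inv True, of "ll(k := 0)"] k ll by simp
  next
    case False
    then have k\<kappa>: "k < \<kappa>"
      by simp
    have lowl: "lam x + (\<Sum>i<k. ret_prob h \<alpha> ll i (Suc k) * w h x T (Suc i)) + l * w h x T (Suc k)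
        \<le> w h x (Suc T) (Suc k)" for x T
      using low[of x T] by (simp add: l_def)
    show ?thesis
    proof (cases "l + lam Noter = 1")
      case True
      \<comment> \<open>\<open>l\<close> and \<open>lam Noter\<close> exhaust the unit mass, so the
        other nonnegative parts of \<open>total\<close> vanish.\<close>
      then have z: "lam Goal = 0" "lam Failed = 0" "R = 0" "q = 0"
        using total lam[of Goal] lam[of Failed] R q(1) by auto
      then have ret_0: "ret_prob h \<alpha> ll i (Suc k) = 0" if "i < k" for i
        using that ret_nn unfolding R_def by (subst (asm) sum_nonneg_eq_0_iff) auto
      then have ret0: "back_prob h \<alpha> ll i (Suc k) = 0 \<and> aloop \<alpha> i k = 0" if "i < k" for i
        using ret_0[OF that] back_nn[of i] D(3)[of i k] by (simp add: ret_prob_def add_nonneg_eq_0_iff)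
      have loop0: "aloop \<alpha> i m = 0" if "i < k" "k \<le> m" "m < length h" for i m
      proof (cases "m = k")
        case False
        then show ?thesis
          using back_prob_eq_0D[of \<alpha> i h "Suc k" ll m] D(3,4) ll ret0[of i] that by simp
      qed (use ret0 that in simp)
      \<comment> \<open>One round through the node: if the value at \<open>T\<close> is at least 1,
        then the value at \<open>Suc T\<close> is at least \<open>lam Noter + l = 1\<close>. This
        also works for \<open>l = 1\<close>.\<close>
      have "w h Noter T (Suc k) \<ge> 1" for T
      proof (rule w_Noter_eq_1)
        fix T assume "w h Noter T (Suc k) \<ge> 1"
        then have "l * 1 \<le> l * w h Noter T (Suc k)"
          using l by (intro mult_left_mono)
        moreover have "0 \<le> (\<Sum>i<k. ret_prob h \<alpha> ll i (Suc k) * w h Noter T (Suc i))"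
          by (intro sum_nonneg mult_nonneg_nonneg ret_nn w_nonneg)
        ultimately show "w h Noter (Suc T) (Suc k) \<ge> 1"
          using lowl[of Noter T] True by simp
      qed
      \<comment> \<open>Goal and failure entries are not cleared by a marking; they vanish because
        \<open>lam Goal\<close> and \<open>lam Failed\<close> do.\<close>
      moreover have "avec \<alpha> x j = 0" if "k < j" "j \<le> length h" "x \<noteq> Noter" for j x
        using that gf[of x j] z(1,2) by (cases x) auto
      ultimately have inv': "invariant h (mark_noter h k \<alpha>) r \<rho> k"
        using q(3) z(4) loop0 by (intro invariant_mark[OF inv k\<kappa>]) auto
      have "calc_lambda_step h k (lam, ll, \<alpha>) =
          ((\<lambda>x. avec (mark_noter h k \<alpha>) x k), ll(k := 0), mark_noter h k \<alpha>)"
        using True by (simp add: calc_loop_eq Let_def flip: l_def)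
      then show ?thesis
        using stage_dead[OF inv' order_refl, of "ll(k := 0)"] k ll by simp
    next
      case nomark: False
      \<comment> \<open>Conservation of mass gives \<open>l + lam Noter \<le> 1\<close>, so a failed
        equality test makes the divisor positive.\<close>
      have l1: "l < 1"
        using nomark total lam[of Goal] lam[of Failed] lam[of Noter] R q(1) by linarith
      define lam' where "lam' x = avec \<alpha> x k + p * lam x / (1 - l)" for x
      define ll' where "ll' = ll(k := l)"
      have step: "calc_lambda_step h k (lam, ll, \<alpha>) = (lam', ll', \<alpha>)"
        using nomark by (simp add: calc_loop_eq lam'_def[abs_def] ll'_def p_def flip: l_def)
      \<comment> \<open>The recursion divides only the direct returns by \<open>1 - l\<close>.
        Dividing the share of the descendants too can only enlarge it, and the fully divided form is
        what solving the value inequality of node \<open>k\<close> yields.\<close>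
      have ret_prob': "ret_prob h \<alpha> ll' i k \<le> p * (ret_prob h \<alpha> ll i (Suc k) / (1 - l)) + aloop \<alpha> i (k - 1)" for i
      proof -
        have "back_prob h \<alpha> ll' i k = p * (back_prob h \<alpha> ll i (Suc k) + aloop \<alpha> i k / (1 - l))"
          using back_prob_cong[of "Suc k" ll' ll h \<alpha> i] k by (simp add: back_prob_rec ll'_def p_def)
        also have "\<dots> \<le> p * (back_prob h \<alpha> ll i (Suc k) / (1 - l) + aloop \<alpha> i k / (1 - l))"
        proof (intro mult_left_mono add_right_mono)
          show "back_prob h \<alpha> ll i (Suc k) \<le> back_prob h \<alpha> ll i (Suc k) / (1 - l)"
            using l l1 back_nn[of i] by (simp add: le_divide_eq mult_left_le)
        qed (use p in simp)
        finally show ?thesis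
          by (simp add: ret_prob_def add_divide_distrib)
      qed
      have low': "lam' x + (\<Sum>i<k. ret_prob h \<alpha> ll' i k * w h x T (Suc i)) \<le> w h x (Suc T) k" for x T
      proof -
        define W where "W = w h x (Suc T) (Suc k)"
        define S where "S = (\<Sum>i<k. ret_prob h \<alpha> ll i (Suc k) * w h x T (Suc i))"
        \<comment> \<open>Replacing the value at \<open>T\<close> by the smaller value at
          \<open>Suc T\<close> puts the same \<open>W\<close> on both sides, and the inequality can
          be solved for \<open>W\<close>.\<close>
        have "l * W \<le> l * w h x T (Suc k)"
          unfolding W_def using l w_antitone by (intro mult_left_mono) auto
        then have "(lam x + S) / (1 - l) \<le> W"
          using lowl[of x T] l1 by (simp add: W_def S_def divide_le_eq algebra_simps)
        then have W: "p * ((lam x + S) / (1 - l)) \<le> p * W"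
          using p by (intro mult_left_mono) auto
        have "(\<Sum>i<k. ret_prob h \<alpha> ll' i k * w h x T (Suc i)) \<le>
            (\<Sum>i<k. (p * (ret_prob h \<alpha> ll i (Suc k) / (1 - l)) + aloop \<alpha> i (k - 1)) * w h x T (Suc i))"
          by (intro sum_mono mult_right_mono ret_prob' w_nonneg)
        also have "\<dots> = p * (S / (1 - l)) + (\<Sum>i<k. aloop \<alpha> i (k - 1) * w h x T (Suc i))"
          by (simp add: S_def sum.distrib algebra_simps sum_distrib_left sum_divide_distrib)
        finally show ?thesis
          using W D(12)[of k x T] D(6)[of k x T] k k\<kappa>
          by (simp add: lam'_def child_def W_def p_def add_divide_distrib distrib_left)
      qed
      \<comment> \<open>Both summands are nonnegative, so zero slack still certifies that nothing is
        unexplored from level \<open>k\<close> on.\<close>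
      define q' where "q' = r k + p * q / (1 - l)"
      have tot': "lam' Goal + lam' Failed + lam' Noter + (\<Sum>i<k. ret_prob h \<alpha> ll' i k) + q' \<le> 1"
      proof -
        have "(\<Sum>i<k. ret_prob h \<alpha> ll' i k) \<le>
            (\<Sum>i<k. p * (ret_prob h \<alpha> ll i (Suc k) / (1 - l)) + aloop \<alpha> i (k - 1))"
          by (intro sum_mono ret_prob')
        also have "\<dots> = p * (R / (1 - l)) + (\<Sum>i<k. aloop \<alpha> i (k - 1))"
          by (simp add: R_def sum.distrib sum_distrib_left sum_divide_distrib)
        moreover have "p * ((lam Goal + lam Failed + lam Noter + R + q) / (1 - l)) \<le> p * 1"
          using total l1 p by (intro mult_left_mono) (auto simp: divide_le_eq)
        ultimately show ?thesis
          using D(8)[of k] k\<kappa>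
          by (simp add: lam'_def q'_def child_def mass_def p_def add_divide_distrib distrib_left)
      qed
      have rk: "0 \<le> r k"
        using D(5) k by simp
      have q'nn: "0 \<le> q'"
        using rk q(1) p l1 by (simp add: q'_def)
      have q'0: "r i = 0" if "q' = 0" "k \<le> i" "i \<le> length h" for i
      proof -
        have "0 \<le> p * q / (1 - l)"
          using q(1) p l1 by simp
        then have "r k = 0 \<and> p * q / (1 - l) = 0"
          using that(1) rk by (simp add: q'_def add_nonneg_eq_0_iff)
        then show ?thesis
          using q(3) that p l1 by (cases "i = k") auto
      qed
      have gf': "avec \<alpha> x i = 0" if "x \<noteq> Noter" "lam' x = 0" "k \<le> i" "i \<le> length h" for x i
      proof -
        have "0 \<le> p * lam x / (1 - l)"
          using lam p l1 by simp
        then have "avec \<alpha> x k = 0 \<and> p * lam x / (1 - l) = 0"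
          using that(2) D(2)[of x k] by (simp add: lam'_def add_nonneg_eq_0_iff)
        then show ?thesis
          using gf[of x i] that p l1 by (cases "i = k") auto
      qed
      have ll': "ll' m < 1 \<and> 0 \<le> ll' m" if "k \<le> m" "m < length h" for m
        using ll[of m] that l l1 by (simp add: ll'_def)
      \<comment> \<open>At the last node \<open>l\<close> is just the diagonal loop entry.\<close>
      have tip': "aloop \<alpha> (length h - 1) (length h - 1) < 1"
      proof (cases "Suc k < length h")
        case False
        then have "length h = Suc k"
          using k by simp
        then show ?thesis
          using l1 by (simp add: l_def ret_prob_def back_prob_end)
      qed (rule tip)
      have lam'nn: "0 \<le> lam' x" for x
        using lam D(2)[of x k] p l1 by (simp add: lam'_def)
      show ?thesis
        unfolding step stage_def prod.case
        using inv k\<kappa> lam'nn ll' low' q'nn tot' q'0 gf' tip' by (meson less_asym)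
    qed
  qed
qed

text \<open>At level 0 no earlier node is left to return to, so \<open>stage\<close> bounds
  \<open>lam\<close> by the value of the root. The third fact keeps the divisor in
  \<open>cumulate_alpha\<close> positive.\<close>

lemma calc_lambda:
  assumes "invariant h \<alpha> r \<rho> \<kappa>" and "calc_lambda h \<alpha> = (lam, \<alpha>')"
  shows "\<exists>\<kappa>'. invariant h \<alpha>' r \<rho> \<kappa>'"
    and "lam x \<le> u x T root"
    and "h \<noteq> [] \<Longrightarrow> aloop \<alpha>' (length h - 1) (length h - 1) < 1"
proof -
  define init where "init = ((\<lambda>x. avec \<alpha> x (length h)), (\<lambda>k :: nat. 0 :: real), \<alpha>)"
  have "stage h r \<rho> j (fold (calc_lambda_step h) (rev [j..<length h]) init)" if "j \<le> length h" for j
    using that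
  proof (induction j rule: inc_induct)
    case base
    show ?case
      using stage_dead[OF assms(1) invariantD(1)[OF assms(1)], of "\<lambda>_. 0"] by (simp add: init_def)
  next
    case (step j)
    then show ?case
      using stage_step[of h r \<rho> j]
      by (cases "fold (calc_lambda_step h) (rev [Suc j..<length h]) init")
         (simp add: upt_conv_Cons del: calc_lambda_step.simps)
  qed
  from this[of 0] obtain ll where "stage h r \<rho> 0 (lam, ll, \<alpha>')"
    using assms(2) unfolding calc_lambda_def init_def[symmetric] by (auto split: prod.splits)
  note st = this[unfolded stage_def prod.case]
  from st obtain \<kappa>' where "invariant h \<alpha>' r \<rho> \<kappa>'"
    by (elim conjE exE)
  then show "\<exists>\<kappa>'. invariant h \<alpha>' r \<rho> \<kappa>'" ..
  from st have "lam x \<le> w h x (Suc T) 0"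
    by (elim conjE) simp
  then show "lam x \<le> u x T root"
    by (simp add: w_def)
  from st show "h \<noteq> [] \<Longrightarrow> aloop \<alpha>' (length h - 1) (length h - 1) < 1"
    by (elim conjE) simp
qed

subsection \<open>Bookkeeping of a single exploration step\<close>

text \<open>Once all children are explored, column \<open>n\<close> contains every return from the
  last node, and the part of its level that does not return to the node itself has mass exactly
  \<open>1 - aloop \<alpha> n n\<close>. After the division it fills the mass of the node exactly,
  so here nothing is lost. If a node was marked, the last level is empty and nothing moves.\<close>

lemma invariant_cumulate:
  assumes inv: "invariant (h @ [v]) \<alpha> r \<rho> \<kappa>" and r: "r (Suc (length h)) = 0"
    and tip: "aloop \<alpha> (length h) (length h) < 1"
  shows "\<exists>\<kappa>'. invariant h (cumulate_alpha (h @ [v]) \<alpha>) r \<rho> \<kappa>'"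
proof -
  note D = invariantD[OF inv]
  define n where "n = length h"
  define p where "p = prob_at (h @ [v]) n"
  define d where "d = 1 - aloop \<alpha> n n"
  define \<alpha>' where "\<alpha>' = cumulate_alpha (h @ [v]) \<alpha>"
  have d: "0 < d"
    using tip by (simp add: d_def n_def)
  have p: "0 < p"
    using D(4)[of n] by (simp add: p_def n_def)
  have avec': "avec \<alpha>' x i = (if i = n then avec \<alpha> x n + p * avec \<alpha> x (Suc n) / d else avec \<alpha> x i)"
    for x i
    by (simp add: \<alpha>'_def cumulate_alpha_def Let_def p_def d_def n_def)
  have aloop': "aloop \<alpha>' i m =
      (if m = n \<and> i \<le> n then 0
       else if Suc m = n \<and> i < n then aloop \<alpha> i m + p * aloop \<alpha> i n / d
       else aloop \<alpha> i m)" for i m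
    by (simp add: \<alpha>'_def cumulate_alpha_def Let_def p_def d_def n_def)
  have w: "w (h @ [v]) x T j = w h x T j" if "j \<le> n" for x T j
    using that by (simp add: w_append n_def)
  have prob: "prob_at (h @ [v]) j = prob_at h j" if "j < n" for j
    using that by (simp add: prob_at_def nth_append n_def)
  have below: "aloop \<alpha>' i (j - 1) = aloop \<alpha> i (j - 1)" if "j < n" "i < j" for i j
    using that by (auto simp: aloop')
  have top: "aloop \<alpha>' i (n - 1) = aloop \<alpha> i (n - 1) + p * aloop \<alpha> i n / d" if "i < n" for i
    using that by (auto simp: aloop')
  have "0 \<le> avec \<alpha>' x j" for x j
    using D(2)[of x j] D(2)[of x n] D(2)[of x "Suc n"] p d by (simp add: avec')
  moreover have "0 \<le> aloop \<alpha>' i m" for i m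
    using D(3)[of i m] D(3)[of i n] p d by (simp add: aloop')
  moreover have "0 < prob_at h j" if "j < length h" for j
    using that D(4)[of j] prob[of j] by (simp add: n_def)
  moreover have "0 \<le> r j" "0 \<le> \<rho> j x T" if "j \<le> length h" for j x T
    using that D(5)[of j] D(6)[of j] by simp_all
  moreover have "aloop \<alpha>' i (length h) = 0" if "i \<le> length h" for i
    using that by (simp add: aloop' n_def)
  ultimately have common: "invariant h \<alpha>' r \<rho> \<kappa>'"
    if "\<kappa>' \<le> length h" "\<And>j. j \<le> \<kappa>' \<Longrightarrow> mass \<alpha>' j + child h \<kappa>' j + r j = 1"
      "\<And>j. \<kappa>' < j \<Longrightarrow> j \<le> length h \<Longrightarrow>
        r j = 0 \<and> (\<forall>x. avec \<alpha>' x j = 0) \<and> (\<forall>i<j. aloop \<alpha>' i (j - 1) = 0)"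
      "\<And>j x T. j \<le> \<kappa>' \<Longrightarrow>
        avec \<alpha>' x j + (\<Sum>i<j. aloop \<alpha>' i (j - 1) * w h x T (Suc i)) +
          child h \<kappa>' j * w h x (Suc T) (Suc j) + \<rho> j x T \<le> w h x (Suc T) j" for \<kappa>'
    using that unfolding invariant_def by simp
  have old_mass: "mass \<alpha>' j = mass \<alpha> j" if "j < n" for j
    using that by (simp add: mass_def avec' below del: One_nat_def)
  have old_low: "avec \<alpha>' x j + (\<Sum>i<j. aloop \<alpha>' i (j - 1) * w h x T (Suc i)) =
      avec \<alpha> x j + (\<Sum>i<j. aloop \<alpha> i (j - 1) * w (h @ [v]) x T (Suc i))" if "j < n" for j x T
    using that by (simp add: avec' below w del: One_nat_def)
  show ?thesis
  proof (cases "\<kappa> = Suc n")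
    case True
    have full: "avec \<alpha> Goal (Suc n) + avec \<alpha> Failed (Suc n) + avec \<alpha> Noter (Suc n) +
        (\<Sum>i<n. aloop \<alpha> i n) = d"
      using D(8)[of "Suc n"] True r by (simp add: mass_def child_def d_def n_def)
    have "invariant h \<alpha>' r \<rho> n"
    proof (rule common)
      fix j assume j: "j \<le> n"
      show "mass \<alpha>' j + child h n j + r j = 1"
      proof (cases "j = n")
        case True
        have "mass \<alpha>' n = mass \<alpha> n + p * ((avec \<alpha> Goal (Suc n) + avec \<alpha> Failed (Suc n) +
            avec \<alpha> Noter (Suc n) + (\<Sum>i<n. aloop \<alpha> i n)) / d)"
          by (simp add: mass_def avec' top sum.distrib sum_distrib_left sum_divide_distrib
              add_divide_distrib distrib_left del: One_nat_def)
        also have "\<dots> = mass \<alpha> n + p"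
          unfolding full using d by simp
        finally show ?thesis
          using D(8)[of n] \<open>\<kappa> = Suc n\<close> True by (simp add: child_def p_def)
      next
        case False
        then show ?thesis
          using D(8)[of j] True j by (simp add: old_mass child_def prob)
      qed
    next
      fix j x T assume j: "j \<le> n"
      show "avec \<alpha>' x j + (\<Sum>i<j. aloop \<alpha>' i (j - 1) * w h x T (Suc i)) +
          child h n j * w h x (Suc T) (Suc j) + \<rho> j x T \<le> w h x (Suc T) j"
      proof (cases "j = n")
        case True
        define W where "W = w (h @ [v]) x (Suc T) (Suc n)"
        define S where "S = (\<Sum>i<n. aloop \<alpha> i n * w h x T (Suc i))"
        have "0 \<le> \<rho> (Suc n) x T"
          using D(6)[of "Suc n"] by (simp add: n_def)
        then have "avec \<alpha> x (Suc n) + S + aloop \<alpha> n n * w (h @ [v]) x T (Suc n) \<le> W"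
          using D(12)[of "Suc n" x T] \<open>\<kappa> = Suc n\<close> by (simp add: S_def W_def w child_def)
        moreover have "aloop \<alpha> n n * W \<le> aloop \<alpha> n n * w (h @ [v]) x T (Suc n)"
          unfolding W_def using D(3) w_antitone by (intro mult_left_mono) auto
        ultimately have "(avec \<alpha> x (Suc n) + S) / d \<le> W"
          using d by (simp add: d_def divide_le_eq algebra_simps)
        then have "p * ((avec \<alpha> x (Suc n) + S) / d) \<le> p * W"
          using p by (intro mult_left_mono) auto
        moreover have "(\<Sum>i<n. aloop \<alpha>' i (n - 1) * w h x T (Suc i)) =
            (\<Sum>i<n. aloop \<alpha> i (n - 1) * w h x T (Suc i)) + p * (S / d)"
          by (simp add: top S_def sum.distrib algebra_simps sum_distrib_left sum_divide_distrib
              del: One_nat_def)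
        moreover have "avec \<alpha> x n + (\<Sum>i<n. aloop \<alpha> i (n - 1) * w h x T (Suc i)) +
            p * W + \<rho> n x T \<le> w h x (Suc T) n"
          using D(12)[of n x T] \<open>\<kappa> = Suc n\<close> by (simp add: W_def child_def p_def w)
        ultimately show ?thesis
          using True by (simp add: avec' child_def add_divide_distrib distrib_left)
      next
        case False
        then show ?thesis
          using D(12)[of j x T] True j by (simp add: old_low child_def prob w del: One_nat_def)
      qed
    qed (simp_all add: n_def)
    then show ?thesis
      by (auto simp: \<alpha>'_def)
  next
    case False
    then have \<kappa>: "\<kappa> \<le> n"
      using D(1) by (simp add: n_def)
    have z: "avec \<alpha> x (Suc n) = 0" "i < Suc n \<Longrightarrow> aloop \<alpha> i n = 0" for x i
      using D(10)[of "Suc n"] D(11)[of "Suc n"] \<kappa> by (simp_all add: n_def)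
    have same: "avec \<alpha>' x j = avec \<alpha> x j" "i < j \<Longrightarrow> j \<le> n \<Longrightarrow> aloop \<alpha>' i (j - 1) = aloop \<alpha> i (j - 1)"
      for x i j
      using z by (auto simp: avec' aloop')
    have "invariant h \<alpha>' r \<rho> \<kappa>"
    proof (rule common)
      fix j assume j: "j \<le> \<kappa>"
      then show "mass \<alpha>' j + child h \<kappa> j + r j = 1"
        using D(8)[of j] \<kappa> by (auto simp: mass_def same child_def prob simp del: One_nat_def)
      show "avec \<alpha>' x j + (\<Sum>i<j. aloop \<alpha>' i (j - 1) * w h x T (Suc i)) +
          child h \<kappa> j * w h x (Suc T) (Suc j) + \<rho> j x T \<le> w h x (Suc T) j" for x T
        using D(12)[of j x T] \<kappa> j by (auto simp: same child_def prob w simp del: One_nat_def)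
    next
      fix j assume "\<kappa> < j" "j \<le> length h"
      then show "r j = 0 \<and> (\<forall>x. avec \<alpha>' x j = 0) \<and> (\<forall>i<j. aloop \<alpha>' i (j - 1) = 0)"
        using D(9)[of j] D(10)[of j] D(11)[of j] same by (simp add: n_def)
    qed (use \<kappa> in \<open>simp add: n_def\<close>)
    then show ?thesis
      by (auto simp: \<alpha>'_def)
  qed
qed

text \<open>The first remaining child of the last level has mass \<open>p\<close> and contributes at least \<open>c\<close>.\<close>

context
  fixes h :: "'s hist" and \<alpha> r \<rho> \<kappa> p c
  assumes inv: "invariant h \<alpha> (r(length h := p + r (length h)))
      (\<rho>(length h := (\<lambda>x T. c x T + \<rho> (length h) x T))) \<kappa>"
    and p: "0 < p" and r: "0 \<le> r (length h)" and \<rho>: "\<And>x T. 0 \<le> \<rho> (length h) x T"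
begin

private lemma alive: "\<kappa> = length h"
  using invariant_alive[OF inv] p r by simp

private lemma nonneg:
  assumes "j \<le> length h"
  shows "0 \<le> r j" "0 \<le> \<rho> j x T"
  using invariantD(5,6)[OF inv assms] r \<rho> by (auto split: if_splits)

lemma invariant_book:
  assumes c: "\<And>x T. p * of_bool (x = y) \<le> c x T"
  shows "invariant h (set_avec y (length h) (avec \<alpha> y (length h) + p) \<alpha>) r \<rho> \<kappa>"
proof -
  note D = invariantD[OF inv]
  define \<alpha>' where "\<alpha>' = set_avec y (length h) (avec \<alpha> y (length h) + p) \<alpha>"
  have avec': "avec \<alpha>' x j = avec \<alpha> x j + (if j = length h then p * of_bool (x = y) else 0)" for x j
    by (auto simp: \<alpha>'_def set_avec_def)
  have aloop': "aloop \<alpha>' = aloop \<alpha>"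
    by (simp add: \<alpha>'_def set_avec_def)
  have "mass \<alpha>' j + child h \<kappa> j + r j = 1" if "j \<le> \<kappa>" for j
    using D(8)[OF that] by (cases y) (auto simp: mass_def avec' aloop' split: if_splits)
  moreover have "avec \<alpha>' x j + (\<Sum>i<j. aloop \<alpha>' i (j - 1) * w h x T (Suc i)) +
      child h \<kappa> j * w h x (Suc T) (Suc j) + \<rho> j x T \<le> w h x (Suc T) j" if "j \<le> \<kappa>" for j x T
    using D(12)[OF that, of x T] c[of x T] by (auto simp: avec' aloop' split: if_splits)
  moreover have "0 \<le> avec \<alpha>' x j" for x j
    using D(2)[of x j] p by (simp add: avec')
  ultimately show ?thesis
    using D(3,4,7) nonneg alive unfolding invariant_def \<alpha>'_def[symmetric] by (simp add: aloop')
qed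

lemma invariant_book_loop:
  assumes k: "k < length h" and c: "\<And>x T. p * w h x T (Suc k) \<le> c x T"
  shows "invariant h (set_aloop k (length h - 1) (aloop \<alpha> k (length h - 1) + p) \<alpha>) r \<rho> \<kappa>"
proof -
  note D = invariantD[OF inv]
  define \<alpha>' where "\<alpha>' = set_aloop k (length h - 1) (aloop \<alpha> k (length h - 1) + p) \<alpha>"
  have avec': "avec \<alpha>' = avec \<alpha>"
    by (simp add: \<alpha>'_def set_aloop_def)
  have aloop': "aloop \<alpha>' i m = aloop \<alpha> i m + (if i = k \<and> m = length h - 1 then p else 0)" for i m
    by (auto simp: \<alpha>'_def set_aloop_def)
  have loops: "(\<Sum>i<j. aloop \<alpha>' i (j - 1) * f i) =
      (\<Sum>i<j. aloop \<alpha> i (j - 1) * f i) + (if j = length h then p * f k else 0)"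
    if "j \<le> length h" for j and f :: "nat \<Rightarrow> real"
  proof (cases "j = length h")
    case True
    have "(\<Sum>i<j. aloop \<alpha>' i (j - 1) * f i) =
        (\<Sum>i<j. aloop \<alpha> i (j - 1) * f i + (if i = k then p * f i else 0))"
      using True by (intro sum.cong) (auto simp: aloop' algebra_simps)
    also have "\<dots> = (\<Sum>i<j. aloop \<alpha> i (j - 1) * f i) + p * f k"
      using k True by (simp add: sum.distrib)
    finally show ?thesis
      using True by simp
  next
    case False
    then have "j - 1 \<noteq> length h - 1 \<or> j = 0"
      using that by auto
    then show ?thesis
      using False by (auto simp: aloop')
  qed
  have "mass \<alpha>' j + child h \<kappa> j + r j = 1" if "j \<le> \<kappa>" for j
    using D(8)[OF that] that loops[of j "\<lambda>_. 1"]
    by (auto simp: mass_def avec' alive split: if_splits)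
  moreover have "avec \<alpha>' x j + (\<Sum>i<j. aloop \<alpha>' i (j - 1) * w h x T (Suc i)) +
      child h \<kappa> j * w h x (Suc T) (Suc j) + \<rho> j x T \<le> w h x (Suc T) j" if "j \<le> \<kappa>" for j x T
    using D(12)[OF that, of x T] c[of x T] that loops[of j "\<lambda>i. w h x T (Suc i)"]
    by (auto simp: avec' alive split: if_splits)
  moreover have "0 \<le> aloop \<alpha>' i m" for i m
    using D(3)[of i m] p by (simp add: aloop')
  moreover have "aloop \<alpha>' i (length h) = 0" if "i \<le> length h" for i
    using D(7)[OF that] k by (auto simp: aloop')
  ultimately show ?thesis
    using D(2,4) nonneg alive unfolding invariant_def \<alpha>'_def[symmetric] by (simp add: avec')
qed

text \<open>As \<open>p = 1\<close>, nothing was booked at the last level before, and assigning 1 is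
  the same as adding \<open>p\<close>. The way from node \<open>k\<close> to the last node and back
  has probability 1, so a round carries the value 1 from \<open>T\<close> to
  \<open>Suc T\<close>.\<close>

lemma invariant_book_cycle:
  assumes k: "k < length h" and cycle: "p = 1" "\<forall>i. k + 1 \<le> i \<and> i \<le> length h - 1 \<longrightarrow> prob_at h i = 1"
    and c: "\<And>x T. w h x T (Suc k) \<le> c x T"
  shows "invariant h (set_avec Noter (length h) 1 \<alpha>) r \<rho> \<kappa>"
proof -
  note D = invariantD[OF inv]
  have "mass \<alpha> (length h) = 0"
  proof -
    have "0 \<le> mass \<alpha> (length h)"
      unfolding mass_def using D(2,3) by (intro add_nonneg_nonneg sum_nonneg) auto
    then show ?thesis
      using D(8)[of "length h"] alive cycle(1) r by (simp add: child_def)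
  qed
  moreover have "0 \<le> (\<Sum>i<length h. aloop \<alpha> i (length h - 1))"
    using D(3) by (intro sum_nonneg) auto
  ultimately have noter: "avec \<alpha> Noter (length h) = 0"
    using D(2)[of Goal "length h"] D(2)[of Failed "length h"] D(2)[of Noter "length h"]
    by (simp add: mass_def)
  have low: "avec \<alpha> x j + (\<Sum>i<j. aloop \<alpha> i (j - 1) * w h x T (Suc i)) \<ge> 0" for x j T
    using D(2,3) by (intro add_nonneg_nonneg sum_nonneg mult_nonneg_nonneg w_nonneg) auto
  have chain: "w h Noter (Suc T) (length h) \<le> w h Noter (Suc T) j"
    if "j \<le> length h" "Suc k \<le> j" for j T
    using that
  proof (induction j rule: inc_induct)
    case (step j)
    then have "prob_at h j = 1"
      using cycle(2) by simp
    then show ?case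
      using step D(12)[of j Noter T] D(6)[of j Noter T] low[of Noter j T] alive
      by (simp add: child_def)
  qed simp
  have "w h Noter T (Suc k) \<ge> 1" for T
  proof (rule w_Noter_eq_1)
    fix T assume "w h Noter T (Suc k) \<ge> 1"
    then have "1 \<le> c Noter T"
      using c order_trans by blast
    also have "\<dots> \<le> w h Noter (Suc T) (length h)"
      using D(12)[of "length h" Noter T] low[of Noter "length h" T] \<rho>[of Noter T] alive
      by (simp add: child_def)
    also have "\<dots> \<le> w h Noter (Suc T) (Suc k)"
      using chain k by simp
    finally show "w h Noter (Suc T) (Suc k) \<ge> 1" .
  qed
  then have "p * of_bool (x = Noter) \<le> c x T" for x T
    using c[of x T] w_nonneg[of h x T "Suc k"] cycle(1) by (cases x) (auto intro: order_trans)
  from invariant_book[OF this] show ?thesis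
    using noter cycle(1) by simp
qed

text \<open>The child turns from unexplored into current. Its returns go to column
  \<open>length h\<close>, whose relevant entries \<open>reset_alpha (Suc (length h))\<close> does
  not clear; \<open>invariant\<close> demands that they are already zero.\<close>

lemma invariant_push:
  assumes c: "\<And>x T. p * u x T (q, s) \<le> c x T"
    and new: "r (Suc (length h)) = 1" "\<And>x T. \<rho> (Suc (length h)) x T \<le> u x (Suc T) (q, s)"
      "\<And>x T. 0 \<le> \<rho> (Suc (length h)) x T"
  shows "invariant (h @ [(q, s, p)]) (reset_alpha (Suc (length h)) \<alpha>) r \<rho> (Suc (length h))"
proof -
  note D = invariantD[OF inv]
  define n where "n = length h"
  define h' where "h' = h @ [(q, s, p)]"
  define \<alpha>' where "\<alpha>' = reset_alpha (Suc n) \<alpha>"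
  have avec': "avec \<alpha>' x j = (if j = Suc n then 0 else avec \<alpha> x j)" for x j
    by (simp add: \<alpha>'_def reset_alpha_def)
  have aloop': "aloop \<alpha>' i m = (if i = Suc n \<or> m = Suc n then 0 else aloop \<alpha> i m)" for i m
    by (simp add: \<alpha>'_def reset_alpha_def)
  have len: "length h' = Suc n"
    by (simp add: h'_def n_def)
  have prob: "prob_at h' j = (if j = n then p else prob_at h j)" if "j \<le> n" for j
    using that by (auto simp: h'_def prob_at_def nth_append n_def)
  have w: "w h' x T j = w h x T j" if "j \<le> n" for x T j
    using that by (simp add: h'_def w_append n_def)
  have col: "i < Suc n \<Longrightarrow> aloop \<alpha> i n = 0" for i
    using D(7)[of i] by (simp add: n_def)
  have old: "aloop \<alpha>' i (j - 1) = aloop \<alpha> i (j - 1)" if "j \<le> n" "i < j" for i j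
    using that by (simp add: aloop')
  have "mass \<alpha>' j + child h' (Suc n) j + r j = 1" if "j \<le> Suc n" for j
  proof (cases "j = Suc n")
    case True
    then show ?thesis
      using new(1) col by (simp add: mass_def child_def avec' aloop' flip: n_def)
  next
    case False
    then show ?thesis
      using D(8)[of j] that by (auto simp: mass_def child_def avec' old prob alive n_def simp del: One_nat_def split: if_splits)
  qed
  moreover have "avec \<alpha>' x j + (\<Sum>i<j. aloop \<alpha>' i (j - 1) * w h' x T (Suc i)) +
      child h' (Suc n) j * w h' x (Suc T) (Suc j) + \<rho> j x T \<le> w h' x (Suc T) j"
    if "j \<le> Suc n" for j x T
  proof -
    consider "j = Suc n" | "j = n" | "j < n"
      using \<open>j \<le> Suc n\<close> by linarith
    then show ?thesis
    proof cases
      case 1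
      then show ?thesis
        using new(2)[of x T] w_snoc[of h q s p x "Suc T"]
        by (simp add: child_def avec' aloop' col flip: n_def h'_def)
    next
      case 2
      have "p * u x (Suc T) (q, s) \<le> p * u x T (q, s)"
        using p u_antitone by simp
      then show ?thesis
        using D(12)[of n x T] 2 c[of x T] w_snoc[of h q s p x "Suc T"]
        by (simp add: child_def avec' old alive prob w del: One_nat_def flip: n_def h'_def)
    next
      case 3
      then show ?thesis
        using D(12)[of j x T] by (simp add: child_def avec' old alive prob w del: One_nat_def flip: n_def)
    qed
  qed
  moreover have "0 < prob_at h' j" if "j < Suc n" for j
    using that D(4)[of j] p by (simp add: prob n_def)
  moreover have "0 \<le> r j" "0 \<le> \<rho> j x T" if "j \<le> Suc n" for j x T
    using that nonneg[of j] new by (cases "j = Suc n"; simp add: n_def)+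
  ultimately show ?thesis
    using D(2,3) unfolding invariant_def n_def[symmetric] \<alpha>'_def[symmetric] h'_def[symmetric] by (simp add: avec' aloop' len)
qed

end

end

subsection \<open>Structure of the search\<close>

lemma set_and_then:
  "set (and_then rs f) = (\<Union>r\<in>set rs. case r of Return C \<alpha> \<Rightarrow> set (f C \<alpha>) | _ \<Rightarrow> {r})"
  by (auto simp: and_then_def split: outcome.splits)

definition pairs :: "'s hist \<Rightarrow> (nat \<times> 's) list" where
  "pairs h = map (\<lambda>v. (fst v, fst (snd v))) h"

lemma revisits_iff: "(\<exists>k. revisits h q s k) \<longleftrightarrow> (q, s) \<in> set (pairs h)"
  unfolding revisits_def pairs_def by (fastforce simp: in_set_conv_nth image_iff)

locale pandor_search =
  fixes P :: "('s, 'a, 'o) problem"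
    and N :: nat
    and L :: real
    and ord_and :: "('s node \<times> real) set \<Rightarrow> ('s node \<times> real) list"
    and ord_or :: "('a command \<times> nat) set \<Rightarrow> ('a command \<times> nat) list"
  assumes problem: "planning_problem P"
    and ord_and: "enumerates ord_and" and ord_or: "enumerates ord_or"
begin

abbreviation "andl \<equiv> and_loop P N L ord_and ord_or"
abbreviation "ors \<equiv> or_step P N L ord_and ord_or"

lemma finite_states: "finite (states (env P))"
  and finite_commands: "finite (commands (env P))"
  and init_state: "init P \<in> states (env P)"
  and obs_state: "s \<in> states (env P) \<Longrightarrow> obs (env P) s \<in> observations (env P)"
  using problem by (simp_all add: planning_problem_def environment_def commands_def)

lemma set_pmf_delta:
  "s \<in> states (env P) \<Longrightarrow> Act a \<in> commands (env P) \<Longrightarrow> set_pmf (delta (env P) s a) \<subseteq> states (env P)"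
  using problem by (auto simp: planning_problem_def environment_def commands_def)

definition ctrl_ok :: "('o, 'a) ctrl \<Rightarrow> bool" where
  "ctrl_ok C \<longleftrightarrow> (\<forall>q ob a q'. C (q, ob) = Some (a, q') \<longrightarrow>
     q < N \<and> ob \<in> observations (env P) \<and> a \<in> commands (env P) \<and> q' < N)"

definition hist_ok :: "'s hist \<Rightarrow> bool" where
  "hist_ok h \<longleftrightarrow> distinct (pairs h) \<and> set (pairs h) \<subseteq> {..<N} \<times> states (env P)"

definition node_ok :: "'s node \<Rightarrow> bool" where
  "node_ok y \<longleftrightarrow> (case y of State s \<Rightarrow> s \<in> states (env P) | _ \<Rightarrow> True)"

lemma node_ok_simps [simp]:
  "node_ok Win" "node_ok Fail" "node_ok (State s) \<longleftrightarrow> s \<in> states (env P)"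
  by (simp_all add: node_ok_def)

lemma hist_ok_length: "hist_ok h \<Longrightarrow> length h \<le> N * card (states (env P))"
proof -
  assume h: "hist_ok h"
  then have "card (set (pairs h)) \<le> card ({..<N} \<times> states (env P))"
    using finite_states by (intro card_mono) (auto simp: hist_ok_def)
  then show ?thesis
    using h distinct_card[of "pairs h"] by (simp add: hist_ok_def card_cartesian_product pairs_def)
qed

lemma hist_ok_snoc:
  "hist_ok h \<Longrightarrow> q < N \<Longrightarrow> s \<in> states (env P) \<Longrightarrow> \<nexists>k. revisits h q s k \<Longrightarrow> hist_ok (h @ [(q, s, p)])"
  unfolding revisits_iff by (auto simp: hist_ok_def pairs_def)

section \<open>Successor sets as probability distributions\<close>

lemma next_states_Act:
  "next_states P s (Act a) =
    (\<lambda>s'. (State s', pmf (delta (env P) s a) s')) ` set_pmf (delta (env P) s a)"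
  unfolding next_states_def by (auto simp: pmf_positive_iff)

lemma next_states_Stop:
  "next_states P s Stop = {(if s \<in> goals P then Win else Fail, 1)}"
  by (simp add: next_states_def)

lemma
  assumes "s \<in> states (env P)" "a \<in> commands (env P)"
  shows finite_next_states: "finite (next_states P s a)"
    and next_states_ok: "(y, p) \<in> next_states P s a \<Longrightarrow> node_ok y \<and> 0 < p"
proof -
  show "finite (next_states P s a)"
  proof (cases a)
    case (Act b)
    then have "finite (set_pmf (delta (env P) s b))"
      using set_pmf_delta assms finite_states finite_subset by blast
    then show ?thesis
      by (simp add: Act next_states_Act)
  qed (simp add: next_states_Stop)
  show "node_ok y \<and> 0 < p" if "(y, p) \<in> next_states P s a"
  proof (cases a)
    case (Act b)
    then show ?thesis
      using that assms set_pmf_delta[OF assms(1), of b] by (auto simp: next_states_Act pmf_positive)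
  qed (use that in \<open>simp add: next_states_Stop split: if_splits\<close>)
qed

lemma sum_next_states_Act:
  fixes g :: "'s node \<Rightarrow> real"
  assumes "s \<in> states (env P)" "Act a \<in> commands (env P)"
  shows "(\<Sum>(y, p)\<in>next_states P s (Act a). p * g y) =
    (\<Sum>s'\<in>states (env P). pmf (delta (env P) s a) s' * g (State s'))"
proof -
  have "(\<Sum>(y, p)\<in>next_states P s (Act a). p * g y) =
      (\<Sum>s'\<in>set_pmf (delta (env P) s a). pmf (delta (env P) s a) s' * g (State s'))"
    unfolding next_states_Act by (subst sum.reindex) (auto simp: inj_on_def)
  also have "\<dots> = (\<Sum>s'\<in>states (env P). pmf (delta (env P) s a) s' * g (State s'))"
    using set_pmf_delta[OF assms] finite_states
    by (intro sum.mono_neutral_left) (auto simp: pmf_eq_0_set_pmf)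
  finally show ?thesis .
qed

lemma sum_next_states_1:
  assumes "s \<in> states (env P)" "a \<in> commands (env P)"
  shows "(\<Sum>(y, p)\<in>next_states P s a. p) = 1"
proof (cases a)
  case (Act b)
  have "(\<Sum>s'\<in>states (env P). pmf (delta (env P) s b) s') = 1"
    using finite_states set_pmf_delta assms Act by (intro sum_pmf_eq_1) auto
  then show ?thesis
    using sum_next_states_Act[of s b "\<lambda>_. 1"] assms Act by simp
qed (simp add: next_states_Stop)

lemma ord_and_next_states:
  assumes "s \<in> states (env P)" "a \<in> commands (env P)"
  shows "set (ord_and (next_states P s a)) = next_states P s a"
    and "(\<Sum>z\<leftarrow>ord_and (next_states P s a). g z) = (\<Sum>z\<in>next_states P s a. g z)"
  using ord_and finite_next_states[OF assms]
  by (auto simp: enumerates_def sum_list_distinct_conv_sum_set)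

lemma set_ord_or: "set (ord_or (commands (env P) \<times> {..<N})) = commands (env P) \<times> {..<N}"
  using ord_or finite_commands by (simp add: enumerates_def)

text \<open>Updating a controller with one of its own transitions changes nothing, so following a
  transition and choosing one take the same form.\<close>

lemma or_step_new:
  assumes "\<nexists>k. revisits h q s k"
  shows "set (ors (Suc d) C q (State s) p h \<alpha>) =
    (\<Union>(a, q')\<in>(case C (q, obs (env P) s) of Some c \<Rightarrow> {c} | None \<Rightarrow> commands (env P) \<times> {..<N}).
       set (andl d (C((q, obs (env P) s) \<mapsto> (a, q'))) q' (ord_and (next_states P s a))
         (h @ [(q, s, p)]) (reset_alpha (Suc (length h)) \<alpha>)))"
proof (cases "C (q, obs (env P) s)")
  case None
  then show ?thesis
    unfolding or_step.simps Let_def if_not_P[OF assms] by (simp add: set_ord_or case_prod_beta)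
next
  case (Some c)
  then show ?thesis
    unfolding or_step.simps Let_def if_not_P[OF assms] by (cases c) (simp add: fun_upd_idem)
qed

section \<open>Growth of the controller and exclusion of cutoffs\<close>

definition grows :: "nat \<Rightarrow> 's hist \<Rightarrow> ('o, 'a) ctrl \<Rightarrow> ('o, 'a) outcome \<Rightarrow> bool" where
  "grows d h C r \<longleftrightarrow>
     (case r of Success C' \<Rightarrow> C \<subseteq>\<^sub>m C' \<and> ctrl_ok C' | Return C' _ \<Rightarrow> C \<subseteq>\<^sub>m C' \<and> ctrl_ok C'
      | Cutoff \<Rightarrow> d + length h \<le> N * card (states (env P)))"

lemma grows_trans: "C \<subseteq>\<^sub>m C' \<Longrightarrow> grows d h C' r \<Longrightarrow> grows d h C r"
  unfolding grows_def by (auto intro: map_le_trans split: outcome.splits)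

lemma and_loop_grows:
  assumes ors: "\<And>C y p \<alpha> r. r \<in> set (ors d C q y p h \<alpha>) \<Longrightarrow> ctrl_ok C \<Longrightarrow> node_ok y \<Longrightarrow> grows d h C r"
    and "r \<in> set (andl d C q SP h \<alpha>)" "ctrl_ok C" "\<And>y p. (y, p) \<in> set SP \<Longrightarrow> node_ok y"
  shows "grows d h C r"
  using assms(2-)
proof (induction SP arbitrary: C \<alpha>)
  case Nil
  then show ?case
    by (simp add: grows_def)
next
  case (Cons z SP)
  obtain y p where z: "z = (y, p)"
    by fastforce
  from Cons.prems(1)[unfolded z and_loop.simps set_and_then] obtain r1 where r1: "r1 \<in> set (ors d C q y p h \<alpha>)"
    and r: "r \<in> (case r1 of
          Return C1 \<alpha>1 \<Rightarrow> set (let (lam, \<alpha>2) = calc_lambda h \<alpha>1 in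
            if lam Goal \<ge> L then [Success C1]
            else if 1 - lam Failed - lam Noter < L then []
            else andl d C1 q SP h \<alpha>2)
        | _ \<Rightarrow> {r1})"
    by (elim UN_E)
  have g1: "grows d h C r1"
    using ors[OF r1] Cons.prems z by auto
  show ?case
  proof (cases r1)
    case (Return C1 \<alpha>1)
    obtain lam \<alpha>2 where lam: "calc_lambda h \<alpha>1 = (lam, \<alpha>2)"
      by fastforce
    have C1: "C \<subseteq>\<^sub>m C1" "ctrl_ok C1"
      using g1 Return by (simp_all add: grows_def)
    from r consider "r = Success C1" | "r \<in> set (andl d C1 q SP h \<alpha>2)"
      by (auto simp: Return lam split: if_splits)
    then show ?thesis
    proof cases
      case 1
      then show ?thesis
        using C1 by (simp add: grows_def)
    next
      case 2
      have "grows d h C1 r"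
        using Cons.prems(3) by (intro Cons.IH[OF 2 C1(2)]) auto
      then show ?thesis
        using grows_trans C1(1) by blast
    qed
  qed (use g1 r in auto)
qed

text \<open>Each nested call trades a unit of depth for a history entry, and distinct pairs bound
  the number of entries. A cutoff thus forces the initial depth to be small.\<close>

lemma or_step_grows:
  assumes "r \<in> set (ors d C q y p h \<alpha>)" "ctrl_ok C" "hist_ok h" "q < N" "node_ok y"
  shows "grows d h C r"
  using assms
proof (induction d arbitrary: r C q y p h \<alpha>)
  case 0
  then show ?case
    using hist_ok_length by (simp add: grows_def)
next
  case (Suc d)
  show ?case
  proof (cases y)
    case (State s)
    show ?thesis
    proof (cases "\<exists>k. revisits h q s k")
      case True
      then show ?thesis
        using Suc.prems by (auto simp: State Let_def grows_def split: if_splits)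
    next
      case False
      have s: "s \<in> states (env P)"
        using Suc.prems State by simp
      let ?ob = "obs (env P) s"
      from Suc.prems(1) obtain a q' where
        aq: "(a, q') \<in> (case C (q, ?ob) of Some c \<Rightarrow> {c} | None \<Rightarrow> commands (env P) \<times> {..<N})"
        and r: "r \<in> set (andl d (C((q, ?ob) \<mapsto> (a, q'))) q' (ord_and (next_states P s a))
          (h @ [(q, s, p)]) (reset_alpha (Suc (length h)) \<alpha>))"
        unfolding State or_step_new[OF False] by auto
      have aq': "a \<in> commands (env P)" "q' < N"
        using aq Suc.prems(2) by (auto simp: ctrl_ok_def split: option.splits)
      let ?C = "C((q, ?ob) \<mapsto> (a, q'))"
      have C: "ctrl_ok ?C" "C \<subseteq>\<^sub>m ?C"
        using aq aq' Suc.prems(2,4) obs_state[OF s]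
        by (auto simp: ctrl_ok_def map_le_def split: option.splits)
      have "grows d (h @ [(q, s, p)]) ?C r"
      proof (rule and_loop_grows[OF _ r C(1)])
        show "node_ok y" if "(y, p') \<in> set (ord_and (next_states P s a))" for y p'
          using that next_states_ok[OF s aq'(1)] ord_and_next_states(1)[OF s aq'(1)] by blast
        show "grows d (h @ [(q, s, p)]) C r"
          if "r \<in> set (ors d C q' y p' (h @ [(q, s, p)]) \<alpha>)" "ctrl_ok C" "node_ok y" for C y p' \<alpha> r
          using Suc.IH[OF that(1,2) hist_ok_snoc] False Suc.prems(3,4) s aq'(2) that(3) by simp
      qed
      then have "grows (Suc d) h ?C r"
        by (auto simp: grows_def split: outcome.splits)
      then show ?thesis
        using grows_trans C(2) by blast
    qed
  qed (use Suc.prems in \<open>auto simp: grows_def\<close>)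
qed

end

subsection \<open>The search maintains the invariant\<close>

text \<open>\<open>u_step\<close> speaks only of defined transitions of \<open>D\<close>, so that a
  partial controller returned by the search can serve as \<open>D\<close>.\<close>

locale pandor_values =
  pandor_search P N L ord_and ord_or + value_family "(0, init P)" u
  for P :: "('s, 'a, 'o) problem" and N L ord_and ord_or u +
  fixes D :: "('o, 'a) ctrl"
  assumes u_step: "D (q, obs (env P) s) = Some (a, q') \<Longrightarrow> s \<in> states (env P) \<Longrightarrow> a \<in> commands (env P) \<Longrightarrow>
    (\<Sum>(y, p)\<in>next_states P s a. p *
      (case y of State s' \<Rightarrow> u x T (q', s') | Win \<Rightarrow> of_bool (x = Goal) | Fail \<Rightarrow> of_bool (x = Failed)))
    \<le> u x (Suc T) (q, s)"
begin

definition val :: "nat \<Rightarrow> kind \<Rightarrow> nat \<Rightarrow> 's node \<Rightarrow> real" where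
  "val q x T y =
     (case y of State s' \<Rightarrow> u x T (q, s') | Win \<Rightarrow> of_bool (x = Goal) | Fail \<Rightarrow> of_bool (x = Failed))"

definition todo_mass :: "('s node \<times> real) list \<Rightarrow> real" where
  "todo_mass SP = (\<Sum>(y, p)\<leftarrow>SP. p)"

definition todo_val :: "nat \<Rightarrow> ('s node \<times> real) list \<Rightarrow> kind \<Rightarrow> nat \<Rightarrow> real" where
  "todo_val q SP x T = (\<Sum>(y, p)\<leftarrow>SP. p * val q x T y)"

lemma todo_simps [simp]:
  "todo_mass [] = 0" "todo_mass ((y, p) # SP) = p + todo_mass SP"
  "todo_val q [] x T = 0" "todo_val q ((y, p) # SP) x T = p * val q x T y + todo_val q SP x T"
  by (simp_all add: todo_mass_def todo_val_def)

lemma val_nonneg: "0 \<le> val q x T y"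
  by (simp add: val_def u_nonneg split: node.splits)

lemma
  assumes "\<And>y p. (y, p) \<in> set SP \<Longrightarrow> 0 < p"
  shows todo_mass_nonneg: "0 \<le> todo_mass SP"
    and todo_val_nonneg: "0 \<le> todo_val q SP x T"
proof -
  have "0 \<le> todo_mass SP \<and> 0 \<le> todo_val q SP x T"
    using assms
  proof (induction SP)
    case (Cons z SP)
    obtain y p where z: "z = (y, p)"
      by fastforce
    have "0 < p"
      using Cons.prems[of y p] z by simp
    moreover have "0 \<le> todo_mass SP \<and> 0 \<le> todo_val q SP x T"
      by (rule Cons.IH, rule Cons.prems, erule list.set_intros(2))
    ultimately show ?case
      by (simp add: z val_nonneg)
  qed simp
  then show "0 \<le> todo_mass SP" "0 \<le> todo_val q SP x T"
    by auto
qed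

definition keeps ::
  "'s hist \<Rightarrow> (nat \<Rightarrow> real) \<Rightarrow> (nat \<Rightarrow> kind \<Rightarrow> nat \<Rightarrow> real) \<Rightarrow> ('o, 'a) outcome \<Rightarrow> bool" where
  "keeps h r \<rho> out \<longleftrightarrow>
     (case out of Return C \<alpha> \<Rightarrow> C \<subseteq>\<^sub>m D \<longrightarrow> (\<exists>\<kappa>. invariant h \<alpha> r \<rho> \<kappa>)
      | Success C \<Rightarrow> C \<subseteq>\<^sub>m D \<longrightarrow> (\<forall>T. L \<le> u Goal T (0, init P))
      | Cutoff \<Rightarrow> True)"

text \<open>A predicate, so that \<open>and_loop_keeps\<close> can assume it at depth
  \<open>d\<close> within the induction that establishes it. \<open>r\<close> and
  \<open>\<rho>\<close> describe what is left after this child; the premise adds the child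
  back.\<close>

definition or_step_keeps :: "nat \<Rightarrow> nat \<Rightarrow> 's hist \<Rightarrow> bool" where
  "or_step_keeps d q h \<longleftrightarrow> (\<forall>out C y p \<alpha> r \<rho> \<kappa>.
     out \<in> set (ors d C q y p h \<alpha>) \<longrightarrow> ctrl_ok C \<longrightarrow> node_ok y \<longrightarrow> 0 < p \<longrightarrow>
     0 \<le> r (length h) \<longrightarrow> (\<forall>x T. 0 \<le> \<rho> (length h) x T) \<longrightarrow>
     invariant h \<alpha> (r(length h := p + r (length h)))
       (\<rho>(length h := (\<lambda>x T. p * val q x T y + \<rho> (length h) x T))) \<kappa> \<longrightarrow>
     keeps h r \<rho> out)"

lemma or_step_keepsD:
  assumes "or_step_keeps d q h"
    and "out \<in> set (ors d C q y p h \<alpha>)" "ctrl_ok C" "node_ok y" "0 < p"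
    and SP: "\<And>y p. (y, p) \<in> set SP \<Longrightarrow> 0 < p"
    and inv: "invariant h \<alpha> (r(length h := todo_mass ((y, p) # SP)))
       (\<rho>(length h := todo_val q ((y, p) # SP))) \<kappa>"
  shows "keeps h (r(length h := todo_mass SP)) (\<rho>(length h := todo_val q SP)) out"
proof -
  have "invariant h \<alpha> ((r(length h := todo_mass SP))(length h := p + (r(length h := todo_mass SP)) (length h)))
       ((\<rho>(length h := todo_val q SP))(length h := (\<lambda>x T. p * val q x T y +
          (\<rho>(length h := todo_val q SP)) (length h) x T))) \<kappa>"
    by (rule invariant_cong[OF inv]) (auto simp: fun_eq_iff)
  from assms(1)[unfolded or_step_keeps_def, rule_format, OF assms(2-5) _ _ this] show ?thesis
    using todo_mass_nonneg[OF SP] todo_val_nonneg[OF SP] by simp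
qed

text \<open>A return from a nonempty history pops its last node, hence \<open>butlast h\<close>. The
  divisor condition is assumed only for an exhausted list; otherwise \<open>calc_lambda\<close> runs
  first and provides it.\<close>

lemma and_loop_keeps:
  assumes ors: "or_step_keeps d q h"
    and q: "q < N" and h: "hist_ok h"
    and "out \<in> set (andl d C q SP h \<alpha>)" "ctrl_ok C"
    and "\<And>y p. (y, p) \<in> set SP \<Longrightarrow> node_ok y \<and> 0 < p"
    and "SP = [] \<Longrightarrow> h \<noteq> [] \<Longrightarrow> aloop \<alpha> (length h - 1) (length h - 1) < 1"
    and "invariant h \<alpha> (r(length h := todo_mass SP)) (\<rho>(length h := todo_val q SP)) \<kappa>"
  shows "h \<noteq> [] \<Longrightarrow> keeps (butlast h) r \<rho> out"
    and "h = [] \<Longrightarrow> SP \<noteq> [] \<Longrightarrow> (case out of Return C' _ \<Rightarrow> \<not> C' \<subseteq>\<^sub>m D | _ \<Rightarrow> keeps h r \<rho> out)"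
proof -
  have "(h \<noteq> [] \<longrightarrow> keeps (butlast h) r \<rho> out) \<and>
    (h = [] \<longrightarrow> SP \<noteq> [] \<longrightarrow> (case out of Return C' _ \<Rightarrow> \<not> C' \<subseteq>\<^sub>m D | _ \<Rightarrow> keeps h r \<rho> out))"
    using assms(4-)
  proof (induction SP arbitrary: C \<alpha> \<kappa>)
    case Nil
    show ?case
    proof (cases "h = []")
      case False
      then obtain h' v where hv: "h = h' @ [v]"
        by (cases h rule: rev_cases) auto
      have out: "out = Return C (cumulate_alpha h \<alpha>)"
        using Nil.prems(1) by simp
      have "\<exists>\<kappa>'. invariant h' (cumulate_alpha h \<alpha>) (r(length h := todo_mass []))
          (\<rho>(length h := todo_val q [])) \<kappa>'"
        unfolding hv
        by (rule invariant_cumulate[OF Nil.prems(5)[unfolded hv]]) (use Nil.prems(4) hv in simp_all)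
      then obtain \<kappa>' where inv': "invariant h' (cumulate_alpha h \<alpha>) (r(length h := todo_mass []))
          (\<rho>(length h := todo_val q [])) \<kappa>'" ..
      have "invariant h' (cumulate_alpha h \<alpha>) r \<rho> \<kappa>'"
        by (rule invariant_cong[OF inv']) (auto simp: hv)
      then show ?thesis
        using False by (auto simp: keeps_def out hv)
    qed simp
  next
    case (Cons z SP)
    obtain y p where z: "z = (y, p)"
      by fastforce
    have SP: "\<And>y p. (y, p) \<in> set SP \<Longrightarrow> node_ok y \<and> 0 < p"
      using Cons.prems(3) by auto
    have y: "node_ok y" "0 < p"
      using Cons.prems(3)[of y p] z by auto
    from Cons.prems(1)[unfolded z and_loop.simps set_and_then] obtain r1 where r1: "r1 \<in> set (ors d C q y p h \<alpha>)"
      and out: "out \<in> (case r1 of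
            Return C1 \<alpha>1 \<Rightarrow> set (let (lam, \<alpha>2) = calc_lambda h \<alpha>1 in
              if lam Goal \<ge> L then [Success C1]
              else if 1 - lam Failed - lam Noter < L then []
              else andl d C1 q SP h \<alpha>2)
          | _ \<Rightarrow> {r1})"
      by (elim UN_E)
    have k1: "keeps h (r(length h := todo_mass SP)) (\<rho>(length h := todo_val q SP)) r1"
      by (rule or_step_keepsD[OF ors r1 Cons.prems(2) y _ Cons.prems(5)[unfolded z]]) (use SP in blast)
    have g1: "grows d h C r1"
      using or_step_grows[OF r1 Cons.prems(2) h q y(1)] .
    show ?case
    proof (cases r1)
      case (Return C1 \<alpha>1)
      obtain lam \<alpha>2 where lam: "calc_lambda h \<alpha>1 = (lam, \<alpha>2)"
        by fastforce
      have C1: "ctrl_ok C1"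
        using g1 Return by (simp add: grows_def)
      have out': "(out = Success C1 \<and> L \<le> lam Goal) \<or>
          (lam Goal < L \<and> L \<le> 1 - lam Failed - lam Noter \<and> out \<in> set (andl d C1 q SP h \<alpha>2))"
        using out by (auto simp: Return lam not_le not_less split: if_splits)
      show ?thesis
      proof (cases "C1 \<subseteq>\<^sub>m D")
        case True
        then obtain \<kappa>1 where inv1: "invariant h \<alpha>1 (r(length h := todo_mass SP))
            (\<rho>(length h := todo_val q SP)) \<kappa>1"
          using k1 Return by (auto simp: keeps_def)
        note cl = calc_lambda[OF inv1 lam]
        obtain \<kappa>2 where inv2: "invariant h \<alpha>2 (r(length h := todo_mass SP))
            (\<rho>(length h := todo_val q SP)) \<kappa>2"
          using cl(1) by blast
        from out' show ?thesis
        proof (elim disjE conjE)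
          assume "out = Success C1" "L \<le> lam Goal"
          then show ?thesis
            using cl(2)[of Goal] by (auto simp: keeps_def intro: order_trans)
        next
          assume l: "lam Goal < L" "L \<le> 1 - lam Failed - lam Noter"
            and o2: "out \<in> set (andl d C1 q SP h \<alpha>2)"
          \<comment> \<open>All mass is booked at level 0, so
            \<open>1 - lam Failed - lam Noter\<close> equals \<open>lam Goal\<close>, and one of the
            tests fires.\<close>
          have False if "h = []" "SP = []"
          proof -
            have "lam x = avec \<alpha>1 x 0" for x
              using lam that(1) by (auto simp: calc_lambda_def)
            moreover have "\<kappa>1 = 0"
              using invariantD(1)[OF inv1] that by simp
            ultimately have "lam Goal + lam Failed + lam Noter = 1"
              using invariantD(8)[OF inv1, of 0] that by (simp add: mass_def child_def)
            then show False
              using l by simp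
          qed
          moreover have "(h \<noteq> [] \<longrightarrow> keeps (butlast h) r \<rho> out) \<and>
            (h = [] \<longrightarrow> SP \<noteq> [] \<longrightarrow> (case out of Return C' _ \<Rightarrow> \<not> C' \<subseteq>\<^sub>m D | _ \<Rightarrow> keeps h r \<rho> out))"
            using Cons.IH[OF o2 C1 SP cl(3) inv2] by blast
          ultimately show ?thesis
            by blast
        qed
      next
        \<comment> \<open>Controllers in later outcomes extend \<open>C1\<close>, so none of them is
          contained in \<open>D\<close>.\<close>
        case False
        have "\<not> C' \<subseteq>\<^sub>m D" if "C1 \<subseteq>\<^sub>m C'" for C'
          using False that map_le_trans by blast
        moreover have "grows d h C1 out"
        proof -
          have "grows d h C1 out" if o2: "out \<in> set (andl d C1 q SP h \<alpha>2)"
            using or_step_grows[OF _ _ h q] SP by (intro and_loop_grows[OF _ o2 C1]) blast+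
          then show ?thesis
            using out' C1 by (auto simp: grows_def)
        qed
        ultimately show ?thesis
          by (auto simp: grows_def keeps_def split: outcome.splits)
      qed
    qed (use k1 out in \<open>auto simp: keeps_def\<close>)
  qed
  then show "h \<noteq> [] \<Longrightarrow> keeps (butlast h) r \<rho> out"
    and "h = [] \<Longrightarrow> SP \<noteq> [] \<Longrightarrow> (case out of Return C' _ \<Rightarrow> \<not> C' \<subseteq>\<^sub>m D | _ \<Rightarrow> keeps h r \<rho> out)"
    by blast+
qed

lemma invariant_push_next:
  assumes inv: "invariant h \<alpha> (r(length h := p + r (length h)))
      (\<rho>(length h := (\<lambda>x T. p * val q x T (State s) + \<rho> (length h) x T))) \<kappa>"
    and "0 < p" "0 \<le> r (length h)" "\<And>x T. 0 \<le> \<rho> (length h) x T"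
    and s: "s \<in> states (env P)" and a: "a \<in> commands (env P)"
    and D: "D (q, obs (env P) s) = Some (a, q')"
  defines "SP \<equiv> ord_and (next_states P s a)" and "h' \<equiv> h @ [(q, s, p)]"
  shows "invariant h' (reset_alpha (Suc (length h)) \<alpha>) (r(length h' := todo_mass SP))
      (\<rho>(length h' := todo_val q' SP)) (Suc (length h))"
    and "SP \<noteq> []"
    and "(y, p') \<in> set SP \<Longrightarrow> node_ok y \<and> 0 < p'"
proof -
  show ok: "node_ok y \<and> 0 < p'" if "(y, p') \<in> set SP" for y p'
    using that next_states_ok[OF s a] ord_and_next_states(1)[OF s a] by (auto simp: SP_def)
  have mass: "todo_mass SP = 1"
    unfolding todo_mass_def SP_def ord_and_next_states(2)[OF s a] by (rule sum_next_states_1[OF s a])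
  then show "SP \<noteq> []"
    by auto
  have val: "todo_val q' SP x T \<le> u x (Suc T) (q, s)" for x T
    using u_step[OF D s a] by (simp add: todo_val_def SP_def ord_and_next_states(2)[OF s a] val_def)
  have inv': "invariant h \<alpha>
      ((r(length h' := todo_mass SP))(length h := p + (r(length h' := todo_mass SP)) (length h)))
      ((\<rho>(length h' := todo_val q' SP))(length h :=
        (\<lambda>x T. p * val q x T (State s) + (\<rho>(length h' := todo_val q' SP)) (length h) x T))) \<kappa>"
    by (rule invariant_cong[OF inv]) (auto simp: h'_def)
  have "0 \<le> todo_val q' SP x T" for x T
    using ok by (intro todo_val_nonneg) blast
  then show "invariant h' (reset_alpha (Suc (length h)) \<alpha>) (r(length h' := todo_mass SP))
      (\<rho>(length h' := todo_val q' SP)) (Suc (length h))"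
    unfolding h'_def using mass val assms(2-4)
    by (intro invariant_push[OF inv'[unfolded h'_def]]) (auto simp: val_def)
qed

lemma or_step_keeps:
  assumes "hist_ok h" "q < N"
  shows "or_step_keeps d q h"
  using assms
proof (induction d arbitrary: q h)
  case 0
  then show ?case
    by (simp add: or_step_keeps_def keeps_def)
next
  case (Suc d)
  show ?case
    unfolding or_step_keeps_def
  proof (intro allI impI)
    fix out C y p \<alpha> r \<rho> \<kappa>
    assume out: "out \<in> set (ors (Suc d) C q y p h \<alpha>)" and C: "ctrl_ok C" and y: "node_ok y"
      and p: "0 < p" and r: "0 \<le> r (length h)" and "\<forall>x T. 0 \<le> \<rho> (length h) x T"
      and inv: "invariant h \<alpha> (r(length h := p + r (length h)))
         (\<rho>(length h := (\<lambda>x T. p * val q x T y + \<rho> (length h) x T))) \<kappa>"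
    then have \<rho>: "0 \<le> \<rho> (length h) x T" for x T
      by simp
    note book = inv p r \<rho>
    show "keeps h r \<rho> out"
    proof (cases y)
      case Win
      have "invariant h (set_avec Goal (length h) (avec \<alpha> Goal (length h) + p) \<alpha>) r \<rho> \<kappa>"
        by (rule invariant_book[OF book]) (simp add: Win val_def)
      then show ?thesis
        using out Win by (auto simp: keeps_def)
    next
      case Fail
      have "invariant h (set_avec Failed (length h) (avec \<alpha> Failed (length h) + p) \<alpha>) r \<rho> \<kappa>"
        by (rule invariant_book[OF book]) (simp add: Fail val_def)
      then show ?thesis
        using out Fail by (auto simp: keeps_def)
    next
      case (State s)
      have s: "s \<in> states (env P)"
        using y State by simp
      show ?thesis
      proof (cases "\<exists>k. revisits h q s k")
        case True
        define k where "k = (LEAST k. revisits h q s k)"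
        have "revisits h q s k"
          unfolding k_def using True by (rule LeastI_ex)
        then have k: "k < length h" and w: "w h x T (Suc k) = val q x T y" for x T
          by (auto simp: revisits_def w_def val_def State)
        show ?thesis
        proof (cases "p = 1 \<and> (\<forall>i. k + 1 \<le> i \<and> i \<le> length h - 1 \<longrightarrow> prob_at h i = 1)")
          case cyc: True
          then have o: "out = Return C (set_avec Noter (length h) 1 \<alpha>)"
            using out True by (simp add: State Let_def flip: k_def)
          have "invariant h (set_avec Noter (length h) 1 \<alpha>) r \<rho> \<kappa>"
            using cyc by (intro invariant_book_cycle[OF book k]) (auto simp: w)
          then show ?thesis
            using o by (auto simp: keeps_def)
        next
          case False
          then have o: "out = Return C (set_aloop k (length h - 1) (aloop \<alpha> k (length h - 1) + p) \<alpha>)"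
            using out[unfolded State or_step.simps Let_def if_P[OF True], folded k_def, unfolded if_not_P[OF False]]
            by simp
          have "invariant h (set_aloop k (length h - 1) (aloop \<alpha> k (length h - 1) + p) \<alpha>) r \<rho> \<kappa>"
            by (rule invariant_book_loop[OF book k]) (simp add: w)
          then show ?thesis
            using o by (auto simp: keeps_def)
        qed
      next
        case False
        let ?ob = "obs (env P) s"
        define h' where "h' = h @ [(q, s, p)]"
        from out obtain a q' where
          aq: "(a, q') \<in> (case C (q, ?ob) of Some c \<Rightarrow> {c} | None \<Rightarrow> commands (env P) \<times> {..<N})"
          and o: "out \<in> set (andl d (C((q, ?ob) \<mapsto> (a, q'))) q' (ord_and (next_states P s a))
            h' (reset_alpha (Suc (length h)) \<alpha>))"
          unfolding State or_step_new[OF False] h'_def by auto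
        have aq': "a \<in> commands (env P)" "q' < N"
          using aq C by (auto simp: ctrl_ok_def split: option.splits)
        let ?C = "C((q, ?ob) \<mapsto> (a, q'))"
        have C': "ctrl_ok ?C"
          using aq aq' C Suc.prems(2) obs_state[OF s]
          by (auto simp: ctrl_ok_def split: option.splits)
        have h': "hist_ok h'"
          unfolding h'_def using Suc.prems s False by (intro hist_ok_snoc)
        have g: "grows d h' ?C out"
          using or_step_grows[OF _ _ h' aq'(2)] next_states_ok[OF s aq'(1)]
            ord_and_next_states(1)[OF s aq'(1)]
          by (intro and_loop_grows[OF _ o C']) blast+
        show ?thesis
        proof (cases "?C \<subseteq>\<^sub>m D")
          case True
          then have D: "D (q, ?ob) = Some (a, q')"
            by (auto simp: map_le_def dest!: bspec[of _ _ "(q, ?ob)"])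
          note push = invariant_push_next[OF inv[unfolded State] p r \<rho> s aq'(1) D, folded h'_def]
          have "keeps (butlast h') r \<rho> out"
            using push(2)
            by (intro and_loop_keeps(1)[OF Suc.IH[OF h' aq'(2)] aq'(2) h' o C' push(3) _ push(1)])
               (auto simp: h'_def)
          then show ?thesis
            by (simp add: h'_def)
        next
          case False
          then have "\<not> C' \<subseteq>\<^sub>m D" if "?C \<subseteq>\<^sub>m C'" for C'
            using that map_le_trans by blast
          then show ?thesis
            using g by (auto simp: grows_def keeps_def split: outcome.splits)
        qed
      qed
    qed
  qed
qed

subsection \<open>The branch that follows a good controller survives\<close>

text \<open>A success or a cutoff ends the search on its branch and may carry any controller. Only a
  return is continued and has to stay within \<open>D\<close>.\<close>

definition survives :: "('o, 'a) outcome list \<Rightarrow> bool" where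
  "survives rs \<longleftrightarrow> (\<exists>r\<in>set rs. case r of Return C _ \<Rightarrow> C \<subseteq>\<^sub>m D | _ \<Rightarrow> True)"

text \<open>\<open>good\<close> speaks of lower bounds \<open>a\<close> and \<open>b\<close> valid
  for all \<open>T\<close>, which is the form in which \<open>calc_lambda\<close> delivers them; the
  pruning test then never fires.\<close>

lemma and_loop_survives:
  assumes good: "\<And>a b. (\<And>T. a \<le> u Failed T (0, init P)) \<Longrightarrow> (\<And>T. b \<le> u Noter T (0, init P)) \<Longrightarrow>
      L \<le> 1 - a - b"
    and q: "q < N" and h: "hist_ok h"
    and ors: "\<And>C y p \<alpha> r \<rho> \<kappa>. C \<subseteq>\<^sub>m D \<Longrightarrow> ctrl_ok C \<Longrightarrow> node_ok y \<Longrightarrow> 0 < p \<Longrightarrow>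
      0 \<le> r (length h) \<Longrightarrow> (\<And>x T. 0 \<le> \<rho> (length h) x T) \<Longrightarrow>
      invariant h \<alpha> (r(length h := p + r (length h)))
        (\<rho>(length h := (\<lambda>x T. p * val q x T y + \<rho> (length h) x T))) \<kappa> \<Longrightarrow>
      survives (ors d C q y p h \<alpha>)"
    and "C \<subseteq>\<^sub>m D" "ctrl_ok C"
    and "\<And>y p. (y, p) \<in> set SP \<Longrightarrow> node_ok y \<and> 0 < p"
    and "invariant h \<alpha> (r(length h := todo_mass SP)) (\<rho>(length h := todo_val q SP)) \<kappa>"
  shows "survives (andl d C q SP h \<alpha>)"
  using assms(5-)
proof (induction SP arbitrary: C \<alpha> \<kappa>)
  case Nil
  then show ?case
    by (simp add: survives_def)
next
  case (Cons z SP)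
  obtain y p where z: "z = (y, p)"
    by fastforce
  have SP: "\<And>y p. (y, p) \<in> set SP \<Longrightarrow> node_ok y \<and> 0 < p"
    using Cons.prems(3) by auto
  have y: "node_ok y" "0 < p"
    using Cons.prems(3)[of y p] z by auto
  have inv: "invariant h \<alpha> ((r(length h := todo_mass SP))(length h := p + (r(length h := todo_mass SP)) (length h)))
       ((\<rho>(length h := todo_val q SP))(length h := (\<lambda>x T. p * val q x T y +
          (\<rho>(length h := todo_val q SP)) (length h) x T))) \<kappa>"
    by (rule invariant_cong[OF Cons.prems(4)]) (auto simp: fun_eq_iff z)
  have "survives (ors d C q y p h \<alpha>)"
    using SP by (intro ors[OF Cons.prems(1,2) y _ _ inv]) (auto intro: todo_mass_nonneg todo_val_nonneg)
  then obtain r1 where r1: "r1 \<in> set (ors d C q y p h \<alpha>)"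
    and D1: "case r1 of Return C _ \<Rightarrow> C \<subseteq>\<^sub>m D | _ \<Rightarrow> True"
    by (auto simp: survives_def)
  have k1: "keeps h (r(length h := todo_mass SP)) (\<rho>(length h := todo_val q SP)) r1"
    by (rule or_step_keepsD[OF or_step_keeps[OF h q] r1 Cons.prems(2) y _ Cons.prems(4)[unfolded z]])
       (use SP in blast)
  have g1: "grows d h C r1"
    using or_step_grows[OF r1 Cons.prems(2) h q y(1)] .
  show ?case
  proof (cases r1)
    case (Return C1 \<alpha>1)
    obtain lam \<alpha>2 where lam: "calc_lambda h \<alpha>1 = (lam, \<alpha>2)"
      by fastforce
    have C1: "C1 \<subseteq>\<^sub>m D" "ctrl_ok C1"
      using g1 D1 Return by (simp_all add: grows_def)
    then obtain \<kappa>1 where inv1: "invariant h \<alpha>1 (r(length h := todo_mass SP))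
        (\<rho>(length h := todo_val q SP)) \<kappa>1"
      using k1 Return by (auto simp: keeps_def)
    note cl = calc_lambda[OF inv1 lam]
    obtain \<kappa>2 where inv2: "invariant h \<alpha>2 (r(length h := todo_mass SP))
        (\<rho>(length h := todo_val q SP)) \<kappa>2"
      using cl(1) by blast
    have "L \<le> 1 - lam Failed - lam Noter"
      by (rule good) (rule cl(2))+
    moreover have "survives (andl d C1 q SP h \<alpha>2)"
      by (rule Cons.IH[OF C1 SP inv2])
    ultimately have "survives (if lam Goal \<ge> L then [Success C1]
            else if 1 - lam Failed - lam Noter < L then []
            else andl d C1 q SP h \<alpha>2)"
      by (simp add: survives_def)
    then show ?thesis
      using r1 unfolding survives_def z and_loop.simps set_and_then
      by (fastforce simp: Return lam)
  next
    case (Success C1)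
    then show ?thesis
      using r1 unfolding survives_def z and_loop.simps set_and_then by force
  next
    case Cutoff
    then show ?thesis
      using r1 unfolding survives_def z and_loop.simps set_and_then by force
  qed
qed

lemma or_step_survives:
  assumes good: "\<And>a b. (\<And>T. a \<le> u Failed T (0, init P)) \<Longrightarrow> (\<And>T. b \<le> u Noter T (0, init P)) \<Longrightarrow>
      L \<le> 1 - a - b"
    and D: "ctrl_ok D" "\<And>q ob. q < N \<Longrightarrow> ob \<in> observations (env P) \<Longrightarrow> D (q, ob) \<noteq> None"
    and "C \<subseteq>\<^sub>m D" "ctrl_ok C" "hist_ok h" "q < N" "node_ok y" "0 < p"
    and "0 \<le> r (length h)" "\<And>x T. 0 \<le> \<rho> (length h) x T"
    and "invariant h \<alpha> (r(length h := p + r (length h)))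
      (\<rho>(length h := (\<lambda>x T. p * val q x T y + \<rho> (length h) x T))) \<kappa>"
  shows "survives (ors d C q y p h \<alpha>)"
  using assms(4-)
proof (induction d arbitrary: C q y p h \<alpha> r \<rho> \<kappa>)
  case 0
  then show ?case
    by (simp add: survives_def)
next
  case (Suc d)
  show ?case
  proof (cases y)
    case (State s)
    have s: "s \<in> states (env P)"
      using Suc.prems(5) State by simp
    show ?thesis
    proof (cases "\<exists>k. revisits h q s k")
      case True
      then show ?thesis
        using Suc.prems(1) by (simp add: survives_def State Let_def)
    next
      case False
      let ?ob = "obs (env P) s"
      define h' where "h' = h @ [(q, s, p)]"
      obtain a q' where aq: "D (q, ?ob) = Some (a, q')"
        using D(2)[OF Suc.prems(4) obs_state[OF s]] by auto
      have aq': "a \<in> commands (env P)" "q' < N"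
        using aq D(1) by (auto simp: ctrl_ok_def)
      let ?C = "C((q, ?ob) \<mapsto> (a, q'))"
      have C': "?C \<subseteq>\<^sub>m D" "ctrl_ok ?C"
        using aq aq' Suc.prems(1,2,4) obs_state[OF s] by (auto simp: ctrl_ok_def map_le_def)
      have "C (q, ?ob) = None \<or> C (q, ?ob) = Some (a, q')"
        using Suc.prems(1) aq by (metis domI map_le_def option.exhaust)
      then have sub: "set (andl d ?C q' (ord_and (next_states P s a)) h' (reset_alpha (Suc (length h)) \<alpha>))
          \<subseteq> set (ors (Suc d) C q y p h \<alpha>)"
        unfolding State or_step_new[OF False] h'_def
        using aq' by (intro subsetI UN_I[of "(a, q')"]) auto
      have h': "hist_ok h'"
        unfolding h'_def using Suc.prems(3,4) s False by (intro hist_ok_snoc)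
      note push = invariant_push_next[OF Suc.prems(9)[unfolded State] Suc.prems(6-8) s aq'(1) aq,
          folded h'_def]
      have "survives (andl d ?C q' (ord_and (next_states P s a)) h' (reset_alpha (Suc (length h)) \<alpha>))"
      proof (rule and_loop_survives[OF good aq'(2) h' _ C' push(3) push(1)])
        show "survives (ors d C q' y p h' \<alpha>)"
          if "C \<subseteq>\<^sub>m D" "ctrl_ok C" "node_ok y" "0 < p" "0 \<le> r (length h')"
            "\<And>x T. 0 \<le> \<rho> (length h') x T"
            "invariant h' \<alpha> (r(length h' := p + r (length h')))
              (\<rho>(length h' := (\<lambda>x T. p * val q' x T y + \<rho> (length h') x T))) \<kappa>" for C y p \<alpha> r \<rho> \<kappa>
          by (rule Suc.IH[OF that(1,2) h' aq'(2) that(3-7)])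
      qed
      then show ?thesis
        using sub by (auto simp: survives_def)
    qed
  qed (use Suc.prems(1) in \<open>simp_all add: survives_def\<close>)
qed

section \<open>The top-level call\<close>

lemma pandor_synth_eq:
  "pandor_synth P N L ord_and ord_or d =
    andl d Map.empty 0 [(State (init P), 1)] [] (reset_alpha 0 alpha_empty)"
proof -
  have "ord_and {(State (init P), 1)} = [(State (init P), 1)]"
  proof -
    have "set (ord_and {(State (init P), 1)}) = {(State (init P), 1)}"
      "distinct (ord_and {(State (init P), 1)})"
      using ord_and by (simp_all add: enumerates_def)
    then show ?thesis
      by (cases "ord_and {(State (init P), 1)}"; cases "tl (ord_and {(State (init P), 1)})") auto
  qed
  then show ?thesis
    by (simp add: pandor_synth_def)
qed

lemma invariant_start:
  "invariant [] (reset_alpha 0 alpha_empty) ((\<lambda>_. 0)(length ([] :: 's hist) := todo_mass [(State (init P), 1)]))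
    ((\<lambda>_ _ _. 0)(length ([] :: 's hist) := todo_val 0 [(State (init P), 1)])) 0"
  by (simp add: invariant_def mass_def child_def reset_alpha_def alpha_empty_def w_def val_def u_nonneg)

lemma hist_ok_Nil: "hist_ok []"
  by (simp add: hist_ok_def pairs_def)

lemma ctrl_ok_empty: "ctrl_ok Map.empty"
  by (simp add: ctrl_ok_def)

lemma pandor_synth_sound:
  assumes "0 < N" "r \<in> set (pandor_synth P N L ord_and ord_or d)"
  shows "case r of Success C \<Rightarrow> C \<subseteq>\<^sub>m D \<longrightarrow> (\<forall>T. L \<le> u Goal T (0, init P))
    | Return C _ \<Rightarrow> \<not> C \<subseteq>\<^sub>m D | Cutoff \<Rightarrow> True"
proof -
  have "case r of Return C' _ \<Rightarrow> \<not> C' \<subseteq>\<^sub>m D | _ \<Rightarrow> keeps [] (\<lambda>_. 0) (\<lambda>_ _ _. 0) r"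
    using assms(2) init_state unfolding pandor_synth_eq
    by (intro and_loop_keeps(2)[OF or_step_keeps[OF hist_ok_Nil assms(1)] assms(1) hist_ok_Nil
          _ ctrl_ok_empty _ _ invariant_start]) auto
  then show ?thesis
    by (auto simp: keeps_def split: outcome.splits)
qed

lemma pandor_synth_survives:
  assumes good: "\<And>a b. (\<And>T. a \<le> u Failed T (0, init P)) \<Longrightarrow> (\<And>T. b \<le> u Noter T (0, init P)) \<Longrightarrow>
      L \<le> 1 - a - b"
    and D: "ctrl_ok D" "\<And>q ob. q < N \<Longrightarrow> ob \<in> observations (env P) \<Longrightarrow> D (q, ob) \<noteq> None"
    and N: "0 < N"
  shows "pandor_synth P N L ord_and ord_or d \<noteq> []"
proof -
  have "survives (pandor_synth P N L ord_and ord_or d)"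
    unfolding pandor_synth_eq
  proof (rule and_loop_survives[OF good N hist_ok_Nil _ _ ctrl_ok_empty _ invariant_start])
    show "survives (ors d C 0 y p [] \<alpha>)"
      if "C \<subseteq>\<^sub>m D" "ctrl_ok C" "node_ok y" "0 < p" "0 \<le> r (length ([] :: 's hist))"
        "\<And>x T. 0 \<le> \<rho> (length ([] :: 's hist)) x T"
        "invariant [] \<alpha> (r(length ([] :: 's hist) := p + r (length ([] :: 's hist))))
          (\<rho>(length ([] :: 's hist) := (\<lambda>x T. p * val 0 x T y + \<rho> (length ([] :: 's hist)) x T))) \<kappa>"
      for C y p \<alpha> r \<rho> \<kappa>
      by (rule or_step_survives[OF good D that(1,2) hist_ok_Nil N that(3-7)])
  qed (use init_state in auto)
  then show ?thesis
    by (auto simp: survives_def)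
qed

end

subsection \<open>Soundness and completeness\<close>

text \<open>Goal and failure values are limits, constant in \<open>T\<close>. Non-termination keeps
  its time bound, since the inductions start from its value 1 at \<open>T = 0\<close>.\<close>

definition final_prob ::
  "('s, 'a, 'o) problem \<Rightarrow> nat \<Rightarrow> ('o, 'a) ctrl \<Rightarrow> kind \<Rightarrow> nat \<Rightarrow> nat \<times> 's \<Rightarrow> real" where
  "final_prob P N D x T v =
     (if x = Noter then stop_prob P (fsc_of N D) Noter T v
      else lim (\<lambda>T. stop_prob P (fsc_of N D) x T v))"

lemma at_fsc_of:
  "command_at P (fsc_of N D) (q, s) = map_option fst (D (q, obs (env P) s))"
  "succ_at P (fsc_of N D) (q, s) = map_option snd (D (q, obs (env P) s))"
  by (simp_all add: command_at_def succ_at_def fsc_of_def)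

context pandor_search
begin

lemma is_fsc_fsc_of:
  assumes "0 < N" "ctrl_ok C"
  shows "is_fsc (env P) (fsc_of N C)"
proof -
  have C: "q < N \<and> ob \<in> observations (env P) \<and> fst c \<in> commands (env P) \<and> snd c < N"
    if "C (q, ob) = Some c" for q ob c
    using that assms(2) by (cases c) (auto simp: ctrl_ok_def)
  show ?thesis
    unfolding is_fsc_def using assms(1) by (auto simp: fsc_of_def ran_def dest!: C)
qed

lemma final_prob_tendsto:
  assumes "x \<noteq> Noter"
  shows "(\<lambda>T. stop_prob P (fsc_of N D) x T v) \<longlonglongrightarrow> final_prob P N D x T' v"
  using stop_prob_tendsto[OF finite_states assms] assms by (simp add: final_prob_def)

text \<open>For \<open>Noter\<close> this is the recursion of \<open>stop_prob\<close>; for the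
  other kinds it is the limit of that recursion.\<close>

lemma final_prob_step:
  assumes D: "D (q, obs (env P) s) = Some (a, q')"
    and s: "s \<in> states (env P)" and a: "a \<in> commands (env P)"
  shows "(\<Sum>(y, p)\<in>next_states P s a. p * (case y of
      State s' \<Rightarrow> final_prob P N D x T (q', s')
    | Win \<Rightarrow> of_bool (x = Goal) | Fail \<Rightarrow> of_bool (x = Failed))) = final_prob P N D x (Suc T) (q, s)"
    (is "?l = ?r")
proof (cases "x = Noter")
  case True
  show ?thesis
  proof (cases a)
    case (Act b)
    then show ?thesis
      using sum_next_states_Act[of s b] s a D True by (simp add: final_prob_def at_fsc_of)
  qed (use True D in \<open>simp add: next_states_Stop final_prob_def at_fsc_of stop_value_def\<close>)
next
  case False
  have lim: "(\<lambda>T. stop_prob P (fsc_of N D) x (Suc T) (q, s)) \<longlonglongrightarrow> ?r"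
    by (rule LIMSEQ_Suc[OF final_prob_tendsto[OF False]])
  show ?thesis
  proof (cases a)
    case (Act b)
    have "(\<lambda>T. stop_prob P (fsc_of N D) x (Suc T) (q, s)) \<longlonglongrightarrow>
        (\<Sum>s'\<in>states (env P). pmf (delta (env P) s b) s' * final_prob P N D x T (q', s'))"
      using D Act by (simp add: at_fsc_of) (intro tendsto_intros final_prob_tendsto False)
    then have "(\<Sum>s'\<in>states (env P). pmf (delta (env P) s b) s' * final_prob P N D x T (q', s')) = ?r"
      using lim LIMSEQ_unique by blast
    then show ?thesis
      using sum_next_states_Act[of s b] s a Act by simp
  next
    case Stop
    have "(\<lambda>T. stop_prob P (fsc_of N D) x (Suc T) (q, s)) \<longlonglongrightarrow> stop_value P x s"
      using D Stop by (simp add: at_fsc_of)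
    then have "stop_value P x s = ?r"
      using lim LIMSEQ_unique by blast
    then show ?thesis
      using Stop False by (cases x) (auto simp: next_states_Stop stop_value_def)
  qed
qed

lemma final_prob_nonneg: "0 \<le> final_prob P N D x T v"
proof (cases "x = Noter")
  case False
  then show ?thesis
    using LIMSEQ_le_const[OF final_prob_tendsto[OF False]] stop_prob_nonneg by metis
qed (simp add: final_prob_def stop_prob_nonneg)

lemma pandor_values_final_prob: "pandor_values P ord_and ord_or (final_prob P N D) D"
proof unfold_locales
  show "0 \<le> final_prob P N D x T v" for x T v
    by (rule final_prob_nonneg)
  show "final_prob P N D x (Suc T) v \<le> final_prob P N D x T v" for x T v
    by (simp add: final_prob_def stop_prob_Noter_Suc_le[OF finite_states] del: stop_prob.simps)
  show "final_prob P N D Noter 0 v = 1" for v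
    by (simp add: final_prob_def)
qed (rule eq_refl[OF final_prob_step])

lemma final_prob_Goal_le_LGT:
  assumes "0 < N" "ctrl_ok C"
  shows "final_prob P N C Goal T (0, init P) \<le> LGT P (fsc_of N C)"
proof (rule LIMSEQ_le_const2[OF final_prob_tendsto])
  show "\<exists>M. \<forall>n\<ge>M. stop_prob P (fsc_of N C) Goal n (0, init P) \<le> LGT P (fsc_of N C)"
    using stop_prob_le_LGT[OF finite_states is_fsc_fsc_of[OF assms] init_state]
    by (simp add: fsc_of_def)
qed simp

lemma pandor_synth_grows:
  assumes "0 < N" "r \<in> set (pandor_synth P N L ord_and ord_or d)"
  shows "grows d [] Map.empty r"
proof -
  interpret pandor_values P N L ord_and ord_or "final_prob P N Map.empty" Map.empty
    by (rule pandor_values_final_prob)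
  show ?thesis
  proof (rule and_loop_grows[OF _ assms(2)[unfolded pandor_synth_eq] ctrl_ok_empty])
    show "grows d [] C r" if "r \<in> set (ors d C 0 y p [] \<alpha>)" "ctrl_ok C" "node_ok y" for C y p \<alpha> r
      by (rule or_step_grows[OF that(1,2) hist_ok_Nil assms(1) that(3)])
  qed (use init_state in auto)
qed

lemma pandor_synth_Success:
  assumes "0 < N" "Success C \<in> set (pandor_synth P N L ord_and ord_or d)"
  shows "ctrl_ok C \<and> L \<le> LGT P (fsc_of N C)"
proof -
  interpret pandor_values P N L ord_and ord_or "final_prob P N C" C
    by (rule pandor_values_final_prob)
  have C: "ctrl_ok C"
    using pandor_synth_grows[OF assms] by (simp add: grows_def)
  have "L \<le> final_prob P N C Goal 0 (0, init P)"
    using pandor_synth_sound[OF assms] by simp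
  also have "\<dots> \<le> LGT P (fsc_of N C)"
    by (rule final_prob_Goal_le_LGT[OF assms(1) C])
  finally show ?thesis
    using C by simp
qed

text \<open>With \<open>D\<close> chosen as \<open>C\<close> itself,
  \<open>pandor_synth_sound\<close> would say that \<open>C\<close> is not contained in
  \<open>C\<close>.\<close>

lemma pandor_synth_Return:
  assumes "0 < N"
  shows "Return C \<alpha> \<notin> set (pandor_synth P N L ord_and ord_or d)"
proof -
  interpret pandor_values P N L ord_and ord_or "final_prob P N C" C
    by (rule pandor_values_final_prob)
  show ?thesis
    using pandor_synth_sound[OF assms, of "Return C \<alpha>" d] by auto
qed

text \<open>Without controller states there is no successor to choose, and at positive depth the
  list of outcomes is empty.\<close>

lemma pandor_synth_0:
  assumes "N = 0" "r \<in> set (pandor_synth P N L ord_and ord_or d)"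
  shows "r = Cutoff"
proof -
  interpret pandor_values P N L ord_and ord_or "final_prob P N Map.empty" Map.empty
    by (rule pandor_values_final_prob)
  have "r \<in> set (and_then (ors d Map.empty 0 (State (init P)) 1 [] (reset_alpha 0 alpha_empty)) f) \<Longrightarrow>
      r = Cutoff" for f
  proof (cases d)
    case (Suc d')
    have new: "\<nexists>k. revisits [] 0 (init P) k"
      by (simp add: revisits_def)
    show "r \<in> set (and_then (ors d Map.empty 0 (State (init P)) 1 [] (reset_alpha 0 alpha_empty)) f) \<Longrightarrow>
        r = Cutoff"
      unfolding Suc set_and_then or_step_new[OF new] using assms(1) by simp
  qed (simp add: and_then_def)
  then show ?thesis
    using assms(2) unfolding pandor_synth_eq and_loop.simps by blast
qed

lemma pandor_returns_sound:
  assumes "pandor_returns P N L ord_and ord_or C"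
  shows "is_fsc (env P) (fsc_of N C) \<and> bounded_by N (fsc_of N C) \<and> LGT P (fsc_of N C) \<ge> L"
proof -
  obtain d r where r: "r \<in> set (pandor_synth P N L ord_and ord_or d)"
    and C: "r = Success C \<or> (\<exists>\<alpha>. r = Return C \<alpha>)"
    using assms unfolding pandor_returns_def by (metis list.set_intros(1))
  have N: "0 < N"
    using pandor_synth_0[OF _ r] C by (cases N) auto
  then have "r = Success C"
    using r C pandor_synth_Return by blast
  then show ?thesis
    using pandor_synth_Success[OF N] r is_fsc_fsc_of[OF N] by (simp add: bounded_by_def fsc_of_def)
qed

lemma pandor_returns_complete:
  assumes N: "0 < N" and D: "ctrl_ok D"
    "\<And>q ob. q < N \<Longrightarrow> ob \<in> observations (env P) \<Longrightarrow> D (q, ob) \<noteq> None"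
    and L: "L \<le> final_prob P N D Goal 0 (0, init P)"
  shows "\<exists>C. pandor_returns P N L ord_and ord_or C"
proof -
  interpret pandor_values P N L ord_and ord_or "final_prob P N D" D
    by (rule pandor_values_final_prob)
  \<comment> \<open>One more than the greatest possible length of a history, which rules out a
    cutoff.\<close>
  let ?d = "Suc (N * card (states (env P)))"
  have "L \<le> 1 - a - b"
    if a: "\<And>T. a \<le> final_prob P N D Failed T (0, init P)"
      and b: "\<And>T. b \<le> final_prob P N D Noter T (0, init P)" for a b
  proof -
    let ?s = "\<lambda>x T. stop_prob P (fsc_of N D) x T (0, init P)"
    \<comment> \<open>The three probabilities are compared at a finite \<open>T\<close>; the limit
      is taken afterwards, for goal and failure only.\<close>
    have "?s Goal T + ?s Failed T \<le> 1 - b" for T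
      using stop_prob_sum_le_1[OF finite_states, of "fsc_of N D" T "(0, init P)"] b[of T]
      by (simp add: final_prob_def)
    moreover have "(\<lambda>T. ?s Goal T + ?s Failed T) \<longlonglongrightarrow>
        final_prob P N D Goal 0 (0, init P) + final_prob P N D Failed 0 (0, init P)"
      by (intro tendsto_add final_prob_tendsto) auto
    ultimately have "final_prob P N D Goal 0 (0, init P) + final_prob P N D Failed 0 (0, init P) \<le> 1 - b"
      by (intro LIMSEQ_le_const2) auto
    then show ?thesis
      using L a[of 0] by simp
  qed
  from pandor_synth_survives[OF this D N, of ?d] obtain r rs
    where r: "pandor_synth P N L ord_and ord_or ?d = r # rs"
    by (cases "pandor_synth P N L ord_and ord_or ?d") auto
  then have "r \<noteq> Cutoff"
    using pandor_synth_grows[OF N, of r ?d] by (auto simp: grows_def)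
  moreover have "r \<noteq> Return C \<alpha>" for C \<alpha>
    using pandor_synth_Return[OF N, of C \<alpha> ?d] r by auto
  ultimately obtain C where "r = Success C"
    by (cases r) auto
  then show ?thesis
    using r unfolding pandor_returns_def by blast
qed

text \<open>Renaming the controller states to numbers, with \<open>stop\<close> and \<open>0\<close> in place of undefined labels
  and transitions, gives a controller that is defined everywhere and reaches the goal at least as
  often.\<close>

lemma ex_total_ctrl:
  fixes D :: "('q, 'o, 'a) fsc"
  assumes D: "is_fsc (env P) D" "bounded_by N D"
  obtains D' where "0 < N" "ctrl_ok D'"
    "\<And>q ob. q < N \<Longrightarrow> ob \<in> observations (env P) \<Longrightarrow> D' (q, ob) \<noteq> None"
    "LGT P D \<le> final_prob P N D' Goal 0 (0, init P)"
proof -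
  let ?M = "cstates D"
  have M: "finite ?M" "start D \<in> ?M" "card ?M \<le> N"
    using D by (auto simp: is_fsc_def bounded_by_def)
  then have N: "0 < N"
    by (metis card_gt_0_iff empty_iff gr0I le_zero_eq not_gr_zero)
  \<comment> \<open>The number 0 is reserved for the start state, which leaves \<open>N - 1\<close>
    numbers for the others.\<close>
  have "\<exists>f. inj_on f (?M - {start D}) \<and> f ` (?M - {start D}) \<subseteq> {1..<N}"
    using M by (intro inj_on_iff_card_le[THEN iffD2]) (auto simp: card_Diff_singleton)
  then obtain f where f: "inj_on f (?M - {start D})" "f ` (?M - {start D}) \<subseteq> {1..<N}"
    by blast
  define \<pi> where "\<pi> q = (if q = start D then 0 else f q)" for q
  have inj: "inj_on \<pi> ?M"
    using f by (fastforce simp: inj_on_def \<pi>_def)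
  have \<pi>: "\<pi> q < N" if "q \<in> ?M" for q
    using f(2) that N by (force simp: \<pi>_def)
  \<comment> \<open>Outside the image of \<open>\<pi>\<close> the value of \<open>inv_into\<close>
    is unspecified, but the entries stay legal: they come from the ranges of \<open>label D\<close>
    and \<open>succ D\<close> or from the defaults.\<close>
  define D' :: "('o, 'a) ctrl" where "D' = (\<lambda>(n, ob).
    if n < N \<and> ob \<in> observations (env P) then
      let q = inv_into ?M \<pi> n in
      Some (case label D (q, ob) of Some c \<Rightarrow> c | None \<Rightarrow> Stop,
            case succ D (q, ob) of Some q' \<Rightarrow> \<pi> q' | None \<Rightarrow> 0)
    else None)"
  have ok: "ctrl_ok D'"
  proof -
    have "c \<in> commands (env P)" if "label D qo = Some c" for qo c
      using D(1) ranI[of "label D", OF that] by (auto simp: is_fsc_def)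
    moreover have "\<pi> q' < N" if "succ D qo = Some q'" for qo q'
      using D(1) ranI[of "succ D", OF that] \<pi> by (auto simp: is_fsc_def)
    ultimately show ?thesis
      using N by (auto simp: ctrl_ok_def D'_def Let_def commands_def split: option.splits if_splits)
  qed
  have total: "D' (q, ob) \<noteq> None" if "q < N" "ob \<in> observations (env P)" for q ob
    using that by (simp add: D'_def Let_def)
  have le: "stop_prob P D Goal T (q, s) \<le> stop_prob P (fsc_of N D') Goal T (\<pi> q, s)"
    if "q \<in> ?M" "s \<in> states (env P)" for T q s
    using that
  proof (induction T arbitrary: q s)
    case (Suc T)
    let ?qo = "(q, obs (env P) s)"
    have D': "D' (\<pi> q, obs (env P) s) = Some
        (case label D ?qo of Some c \<Rightarrow> c | None \<Rightarrow> Stop, case succ D ?qo of Some q' \<Rightarrow> \<pi> q' | None \<Rightarrow> 0)"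
      using Suc.prems inj \<pi> obs_state by (simp add: D'_def Let_def inv_into_f_f)
    show ?case
    proof (cases "\<exists>a q'. label D ?qo = Some (Act a) \<and> succ D ?qo = Some q'")
      case True
      then obtain a q' where aq: "label D ?qo = Some (Act a)" "succ D ?qo = Some q'"
        by blast
      have "q' \<in> ?M"
        using D(1) ranI[of "succ D", OF aq(2)] by (auto simp: is_fsc_def)
      then show ?thesis
        using aq D' Suc.IH
        by (auto simp: at_fsc_of command_at_def[of P D] succ_at_def[of P D] intro!: sum_mono mult_left_mono)
    next
      case False
      \<comment> \<open>Where \<open>D\<close> is stuck, its goal probability is 0; where it stops,
        both controllers stop in the same environment state.\<close>
      then consider "label D ?qo = None" | "label D ?qo = Some Stop"
        | "succ D ?qo = None" "\<exists>a. label D ?qo = Some (Act a)"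
        by (metis command.exhaust not_Some_eq)
      then show ?thesis
        using D' stop_prob_nonneg[of P "fsc_of N D'" Goal "Suc T" "(\<pi> q, s)"]
        by cases (auto simp: at_fsc_of command_at_def[of P D] succ_at_def[of P D] simp del: stop_prob.simps(2)
            simp: stop_prob.simps(2)[of P D] stop_prob.simps(2)[of P "fsc_of N D'" Goal T "(\<pi> q, s)"])
    qed
  qed simp
  have "LGT P D \<le> final_prob P N D' Goal 0 (0, init P)"
  proof (rule LGT_le[OF finite_states D(1) init_state])
    fix T
    have "stop_prob P D Goal T (start D, init P) \<le> stop_prob P (fsc_of N D') Goal T (0, init P)"
      using le[OF M(2) init_state] by (simp add: \<pi>_def)
    also have "\<dots> \<le> final_prob P N D' Goal 0 (0, init P)"
      using stop_prob_le_lim[OF finite_states, of Goal "fsc_of N D'" T "(0, init P)"]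
      by (simp add: final_prob_def)
    finally show "stop_prob P D Goal T (start D, init P) \<le> final_prob P N D' Goal 0 (0, init P)" .
  qed
  then show thesis
    using that N ok total by blast
qed

end

theorem theorem3:
  fixes P :: "('s, 'a, 'o) problem"
    and N :: nat
    and L :: real
    and ord_and :: "('s node \<times> real) set \<Rightarrow> ('s node \<times> real) list"
    and ord_or :: "('a command \<times> nat) set \<Rightarrow> ('a command \<times> nat) list"
  assumes "planning_problem P"
    and "0 < L" and "L < 1"
    and "enumerates ord_and" and "enumerates ord_or"
  shows
    "(\<forall>C. pandor_returns P N L ord_and ord_or C \<longrightarrow>
        is_fsc (env P) (fsc_of N C) \<and> bounded_by N (fsc_of N C) \<and> LGT P (fsc_of N C) \<ge> L) \<and>
     ((\<exists>D :: ('q, 'o, 'a) fsc. is_fsc (env P) D \<and> bounded_by N D \<and> LGT P D \<ge> L) \<longrightarrow>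
        (\<exists>C. pandor_returns P N L ord_and ord_or C \<and>
           is_fsc (env P) (fsc_of N C) \<and> bounded_by N (fsc_of N C) \<and> LGT P (fsc_of N C) \<ge> L))"
proof -
  interpret pandor_search P N L ord_and ord_or
    by unfold_locales fact+
  have "\<exists>C. pandor_returns P N L ord_and ord_or C"
    if D: "is_fsc (env P) D" "bounded_by N D" "LGT P D \<ge> L" for D :: "('q, 'o, 'a) fsc"
  proof -
    obtain D' where "0 < N" "ctrl_ok D'"
      "\<And>q ob. q < N \<Longrightarrow> ob \<in> observations (env P) \<Longrightarrow> D' (q, ob) \<noteq> None"
      "LGT P D \<le> final_prob P N D' Goal 0 (0, init P)"
      using ex_total_ctrl[OF D(1,2)] by metis
    then show ?thesis
      using D(3) by (intro pandor_returns_complete) auto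
  qed
  then show ?thesis
    using pandor_returns_sound by blast
qed

end
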